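(* Let $n\ge 1$, let $1\le p\le 2$, and let $A$ and $B$ be self-adjoint complex $n\times n$ matrices with $A\ge B\ge 0$. Then $$\|A+B\|_p^p+\|A-B\|_p^p\ \ge\ \|\Sigma_\uparrow(A)+\Sigma_\uparrow(B)\|_p^p+\|\Sigma_\uparrow(A)-\Sigma_\uparrow(B)\|_p^p .$$
   Context: For an $n\times n$ complex matrix $X$, $|X|=\sqrt{X^*X}$ and, for $1\le p<\infty$, $\|X\|_p=(\mathrm{Tr}\,|X|^p)^{1/p}$ is the $C^p$ trace norm. $X\ge Y$ means that $X-Y$ is positive semidefinite. If $\sigma_1\ge\sigma_2\ge\dots\ge\sigma_n\ge 0$ are the singular values of $X$ (the eigenvalues of $|X|$, counted with multiplicity), then $\Sigma_\uparrow(X)=\mathrm{diag}(\sigma_1,\sigma_2,\dots,\sigma_n)$ is the diagonal matrix with the singular values listed in this order down the diagonal. *)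

theory Defs
  imports "Jordan_Normal_Form.Schur_Decomposition"
begin

definition mat_trace :: "complex mat \<Rightarrow> complex" where
  "mat_trace X = (\<Sum>i<dim_row X. X $$ (i, i))"

definition self_adjoint :: "complex mat \<Rightarrow> bool" where
  "self_adjoint X \<longleftrightarrow> square_mat X \<and> mat_adjoint X = X"

definition unitary_mat :: "complex mat \<Rightarrow> bool" where
  "unitary_mat U \<longleftrightarrow> square_mat U \<and> mat_adjoint U * U = 1\<^sub>m (dim_row U)"

definition pos_semidef :: "complex mat \<Rightarrow> bool" where
  "pos_semidef X \<longleftrightarrow> self_adjoint X \<and> (\<forall>v \<in> carrier_vec (dim_row X). 0 \<le> Re ((X *\<^sub>v v) \<bullet>c v))"

(* The order on type mat provided by the library is the entrywise one, so the
   positive semidefinite order needs its own symbol. *)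
definition loewner_ge :: "complex mat \<Rightarrow> complex mat \<Rightarrow> bool" (infix \<open>\<succeq>\<close> 50) where
  "X \<succeq> Y \<longleftrightarrow> pos_semidef (X - Y)"

definition unitary_diag :: "complex mat \<Rightarrow> complex mat \<Rightarrow> (nat \<Rightarrow> real) \<Rightarrow> bool" where
  "unitary_diag X U d \<longleftrightarrow> unitary_mat U \<and> dim_row U = dim_row X \<and>
     X = U * mat_diag (dim_row X) (\<lambda>i. of_real (d i)) * mat_adjoint U"

(* Functional calculus for a self-adjoint matrix X.  The value does not depend on the
   chosen diagonalization (see mat_fun_eq); for X that is not self-adjoint it is
   unspecified. *)
definition mat_fun :: "(real \<Rightarrow> real) \<Rightarrow> complex mat \<Rightarrow> complex mat" where
  "mat_fun f X = (THE Y. \<exists>U d. unitary_diag X U d \<and>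
     Y = U * mat_diag (dim_row X) (\<lambda>i. of_real (f (d i))) * mat_adjoint U)"

definition mat_abs :: "complex mat \<Rightarrow> complex mat" where
  "mat_abs X = mat_fun sqrt (mat_adjoint X * X)"

(* The trace of the positive semidefinite matrix |X|^p is real; Re merely converts its type. *)
definition trace_norm :: "real \<Rightarrow> complex mat \<Rightarrow> real" where
  "trace_norm p X = Re (mat_trace (mat_fun (\<lambda>t. t powr p) (mat_abs X))) powr (1 / p)"

(* Eigenvalues of |X| with algebraic multiplicity (they are real), in decreasing order. *)
definition singular_values :: "complex mat \<Rightarrow> real list" where
  "singular_values X =
     rev (sorted_list_of_multiset (image_mset Re (proots (char_poly (mat_abs X)))))"

(* The entries decrease down the diagonal: position 0 holds the largest singular value. *)
definition Sigma_up :: "complex mat \<Rightarrow> complex mat" (\<open>\<Sigma>\<^sub>\<up>\<close>) where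
  "\<Sigma>\<^sub>\<up> X = mat_diag (dim_row X) (\<lambda>i. of_real (singular_values X ! i))"

lemma mat_adjoint_carrier: "U \<in> carrier_mat n m \<Longrightarrow> mat_adjoint U \<in> carrier_mat m n"
  unfolding mat_adjoint_def mat_of_rows_def carrier_mat_def by auto

lemma unitary_diag_fun_unique:
  assumes 1: "unitary_diag X U d" and 2: "unitary_diag X V e"
  shows "U * mat_diag (dim_row X) (\<lambda>i. of_real (f (d i))) * mat_adjoint U =
         V * mat_diag (dim_row X) (\<lambda>i. of_real (f (e i))) * mat_adjoint V"
proof -
  define n where "n = dim_row X"
  define D where "D = mat_diag n (\<lambda>i. complex_of_real (d i))"
  define E where "E = mat_diag n (\<lambda>i. complex_of_real (e i))"
  define F where "F = mat_diag n (\<lambda>i. complex_of_real (f (d i)))"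
  define G where "G = mat_diag n (\<lambda>i. complex_of_real (f (e i)))"
  define U' where "U' = mat_adjoint U"
  define V' where "V' = mat_adjoint V"
  define W where "W = V' * U"
  have U: "U \<in> carrier_mat n n" and V: "V \<in> carrier_mat n n"
    and UU: "U' * U = 1\<^sub>m n" and VV: "V' * V = 1\<^sub>m n"
    using 1 2 unfolding unitary_diag_def unitary_mat_def carrier_mat_def
      square_mat.simps n_def U'_def V'_def by simp_all
  have XU: "X = U * D * U'" and XV: "X = V * E * V'"
    using 1 2 unfolding unitary_diag_def n_def D_def E_def U'_def V'_def by blast+
  have U': "U' \<in> carrier_mat n n" and V': "V' \<in> carrier_mat n n"
    using U V by (auto simp: U'_def V'_def intro: mat_adjoint_carrier)
  have DE: "D \<in> carrier_mat n n" "E \<in> carrier_mat n n" "F \<in> carrier_mat n n" "G \<in> carrier_mat n n"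
    by (auto simp: D_def E_def F_def G_def)
  have W: "W \<in> carrier_mat n n" using U V' by (auto simp: W_def)
  have UU2: "U * U' = 1\<^sub>m n" and VV2: "V * V' = 1\<^sub>m n"
    using mat_mult_left_right_inverse[OF U' U UU] mat_mult_left_right_inverse[OF V' V VV] by auto
  note assoc = assoc_mult_mat[of _ n n _ n _ n]
  have "V' * X * U = W * D"
  proof -
    have "V' * X * U = V' * U * D * (U' * U)"
      using U U' V' DE unfolding XU by (simp add: assoc)
    then show ?thesis using U V' DE by (simp add: UU W_def)
  qed
  moreover have "V' * X * U = E * W"
  proof -
    have "V' * X * U = (V' * V) * (E * (V' * U))"
      using V U V' DE unfolding XV by (simp add: assoc)
    then show ?thesis using U V' DE by (simp add: VV W_def)
  qed
  ultimately have eq: "W * D = E * W" by simp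
  have "W $$ (i, j) * of_real (d j) = of_real (e i) * W $$ (i, j)" if "i < n" "j < n" for i j
    using arg_cong[OF eq, of "\<lambda>M. M $$ (i, j)"] that W
    unfolding D_def E_def mat_diag_mult_left[OF W] mat_diag_mult_right[OF W] by auto
  then have "W $$ (i, j) = 0 \<or> d j = e i" if "i < n" "j < n" for i j
    using that by (metis mult.commute mult_cancel_left of_real_eq_iff)
  then have "W $$ (i, j) * of_real (f (d j)) = of_real (f (e i)) * W $$ (i, j)"
    if "i < n" "j < n" for i j
    using that by (metis mult.commute mult_zero_left)
  then have FG: "W * F = G * W"
    unfolding F_def G_def mat_diag_mult_left[OF W] mat_diag_mult_right[OF W]
    by (intro eq_matI) auto
  have "V * G * V' = V * (G * W) * U'"
    using V U U' V' DE by (simp add: W_def assoc UU2)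
  also have "\<dots> = (V * V') * (U * F * U')"
    using V U U' V' DE W unfolding FG[symmetric] by (simp add: W_def assoc)
  also have "\<dots> = U * F * U'" using U U' DE by (simp add: VV2)
  finally show ?thesis by (simp add: F_def G_def U'_def V'_def n_def)
qed

lemma mat_fun_eq:
  assumes "unitary_diag X U d"
  shows "mat_fun f X = U * mat_diag (dim_row X) (\<lambda>i. of_real (f (d i))) * mat_adjoint U"
  unfolding mat_fun_def
  using assms unitary_diag_fun_unique[OF _ assms, of _ _ f] by (intro the_equality) blast+

end

theory Submission
  imports "HOL-Analysis.Equivalence_Lebesgue_Henstock_Integration" "HOL-Real_Asymp.Real_Asymp" Defs
begin

unbundle no vec_syntax

text \<open>
  The inequality is reduced to one about determinants. For \<open>1 < p < 2\<close> and \<open>t \<ge> 0\<close>, scaling gives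
  \[ K t^p = \int_0^\infty s^{p-1} \bigl( t/s - \log(1 + t/s) \bigr)\, ds \]
  with a constant \<open>K > 0\<close>. Sum this over the eigenvalues of \<open>A + B\<close> and \<open>A - B\<close> (both are
  positive semidefinite), and likewise over the numbers \<open>a\<^sub>i + b\<^sub>i\<close> and \<open>a\<^sub>i - b\<^sub>i\<close>, where \<open>a\<close> and \<open>b\<close>
  are the decreasing eigenvalues of \<open>A\<close> and \<open>B\<close>. The linear terms agree, because both families have
  sum \<open>2 Tr A\<close>. Only the logarithms remain, so it suffices that for every \<open>s > 0\<close>
  \[ \det(s + A + B)\, \det(s + A - B) \le \prod_i \bigl( (s + a_i)^2 - b_i^2 \bigr). \]
  The endpoints \<open>p = 1\<close> and \<open>p = 2\<close> follow by continuity in \<open>p\<close> (\<open>sum_powr_le\<close>).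

  For the determinants, diagonalize \<open>s + A\<close> and \<open>B\<close> by one congruence: \<open>s + A = S S\<^sup>*\<close> and
  \<open>B = S diag(c) S\<^sup>*\<close> with \<open>0 \<le> c\<^sub>i < 1\<close>. The left side is then \<open>det(s + A)\<^sup>2 \<Prod>(1 - c\<^sub>i\<^sup>2)\<close>, and
  the claim becomes \<open>\<Prod>(1 - c\<^sub>i\<^sup>2) \<le> \<Prod>(1 - y\<^sub>i\<^sup>2)\<close> for \<open>y\<^sub>i = b\<^sub>i/(s + a\<^sub>i)\<close>. Given \<open>\<theta> > 0\<close>, the
  matrix \<open>M = S diag(max c\<^sub>i \<theta>) S\<^sup>*\<close> dominates both \<open>B\<close> and \<open>\<theta>(s + A)\<close>. By Weyl monotonicity its
  \<open>i\<close>-th eigenvalue is at least \<open>max b\<^sub>i (\<theta>(s + a\<^sub>i))\<close>, and comparing with \<open>det M\<close> yields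
  \<open>\<Prod> max y\<^sub>i \<theta> \<le> \<Prod> max c\<^sub>i \<theta>\<close>. This is the trick behind multiplicative Lidskii inequalities: it
  copes with the fact that the quotients \<open>y\<^sub>i\<close> need not be monotone in \<open>i\<close>. Finally
  \<open>- log(1 - t\<^sup>2)\<close> is a nonnegative mixture over \<open>\<theta>\<close> of the functions \<open>log(max t \<theta>/\<theta>)\<close>, so the
  inequalities for all \<open>\<theta>\<close> together imply the claim (\<open>prod_one_minus_square_le\<close>, \<open>det_sum_diff_le\<close>).
\<close>

section \<open>A layer-cake comparison of products\<close>

text \<open>
  The function \<open>g t = - ln (1 - t\<^sup>2)\<close> is convex in \<open>ln t\<close>, and the weight is the derivative of
  \<open>\<theta> \<mapsto> \<theta> * g' \<theta> = 2 * \<theta>\<^sup>2 / (1 - \<theta>\<^sup>2)\<close>; one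
  integration by parts leaves the integral of \<open>g'\<close>. The upper limit
  stays below \<open>1\<close>, where the weight is singular; the integrand vanishes beyond \<open>t\<close> anyway.
\<close>

lemma has_integral_minus_ln_one_minus_square:
  fixes t \<tau> :: real
  assumes "0 \<le> t" "t \<le> \<tau>" "\<tau> < 1"
  shows "((\<lambda>\<theta>. 4 * \<theta> / (1 - \<theta>\<^sup>2)\<^sup>2 * (ln (max t \<theta>) - ln \<theta>)) has_integral - ln (1 - t\<^sup>2)) {0..\<tau>}"
    (is "(?f has_integral _) _")
proof -
  define F where "F \<theta> = (ln t - ln \<theta>) * (2 * \<theta>\<^sup>2 / (1 - \<theta>\<^sup>2)) - ln (1 - \<theta>\<^sup>2)" for \<theta> :: real
  have sq: "\<theta>\<^sup>2 < 1" if "0 \<le> \<theta>" "\<theta> \<le> t" for \<theta> :: real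
    using that assms by (simp add: power_less_one_iff)
  have left: "(?f has_integral - ln (1 - t\<^sup>2)) {0..t}"
  proof (cases "t = 0")
    case True
    then show ?thesis using has_integral_refl(2)[of ?f "0::real"] by simp
  next
    case False
    then have t: "0 < t" using assms by simp
    \<comment> \<open>\<open>F\<close> is the antiderivative from integration by parts; \<open>ln 0 = 0\<close> and \<open>\<theta>\<^sup>2 * ln \<theta> \<longlongrightarrow> 0\<close> make it continuous at \<open>0\<close>.\<close>
    have "(F \<longlongrightarrow> 0) (at_right 0)" unfolding F_def by real_asymp
    then have "continuous (at 0 within {0..t}) F"
      using t by (simp add: continuous_within at_within_Icc_at_right F_def)
    moreover have "continuous (at \<theta> within {0..t}) F" if "0 < \<theta>" "\<theta> \<le> t" for \<theta>
      unfolding F_def using sq[of \<theta>] that by (intro continuous_intros) auto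
    ultimately have cont: "continuous_on {0..t} F"
      by (metis atLeastAtMost_iff continuous_on_eq_continuous_within less_eq_real_def)
    have deriv: "(F has_vector_derivative ?f \<theta>) (at \<theta>)" if "\<theta> \<in> {0<..<t}" for \<theta>
    proof -
      have \<theta>: "0 < \<theta>" "\<theta> < t" and ne: "1 - \<theta>\<^sup>2 \<noteq> 0" and pos: "1 - \<theta>\<^sup>2 > 0"
        using that sq[of \<theta>] by auto
      have "((\<lambda>\<theta>. 2 * \<theta>\<^sup>2 / (1 - \<theta>\<^sup>2)) has_real_derivative 4 * \<theta> / (1 - \<theta>\<^sup>2)\<^sup>2) (at \<theta>)"
        using ne by (auto intro!: derivative_eq_intros simp: field_simps power2_eq_square)
      moreover have "((\<lambda>\<theta>. ln t - ln \<theta>) has_real_derivative - (1 / \<theta>)) (at \<theta>)"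
        using \<theta> by (auto intro!: derivative_eq_intros)
      moreover have "((\<lambda>\<theta>. ln (1 - \<theta>\<^sup>2)) has_real_derivative - (2 * \<theta> / (1 - \<theta>\<^sup>2))) (at \<theta>)"
        using pos by (auto intro!: derivative_eq_intros)
      ultimately have "(F has_real_derivative
          (- (1/\<theta>) * (2 * \<theta>\<^sup>2 / (1 - \<theta>\<^sup>2)) + 4 * \<theta> / (1 - \<theta>\<^sup>2)\<^sup>2 * (ln t - ln \<theta>))
          - (- (2 * \<theta> / (1 - \<theta>\<^sup>2)))) (at \<theta>)"
        unfolding F_def by (intro DERIV_diff DERIV_mult)
      moreover have "- (1/\<theta>) * (2 * \<theta>\<^sup>2 / (1 - \<theta>\<^sup>2)) = - (2 * \<theta> / (1 - \<theta>\<^sup>2))"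
        using \<theta> by (simp add: power2_eq_square)
      ultimately have "(F has_real_derivative (ln t - ln \<theta>) * (4 * \<theta> / (1 - \<theta>\<^sup>2)\<^sup>2)) (at \<theta>)"
        by (simp add: mult.commute)
      then show ?thesis
        using \<theta> by (simp add: max_def has_real_derivative_iff_has_vector_derivative mult.commute)
    qed
    have "(?f has_integral F t - F 0) {0..t}"
      using t cont deriv by (intro fundamental_theorem_of_calculus_interior) auto
    then show ?thesis by (simp add: F_def)
  qed
  have right: "(?f has_integral 0) {t..\<tau>}"
    by (rule has_integral_is_0) (simp add: max_def)
  show ?thesis
    using has_integral_combine[OF assms(1,2) left right] by simp
qed

text \<open>
  After taking logarithms, the hypothesis compares the integrands of the preceding formula at every
  \<open>\<theta>\<close>, and the conclusion compares the integrals.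
\<close>

lemma prod_one_minus_square_le:
  fixes c y :: "'i \<Rightarrow> real"
  assumes J: "finite J"
    and c: "\<And>i. i \<in> J \<Longrightarrow> 0 \<le> c i \<and> c i < 1"
    and y: "\<And>i. i \<in> J \<Longrightarrow> 0 \<le> y i \<and> y i < 1"
    and le: "\<And>\<theta>. 0 < \<theta> \<Longrightarrow> (\<Prod>i\<in>J. max (y i) \<theta>) \<le> (\<Prod>i\<in>J. max (c i) \<theta>)"
  shows "(\<Prod>i\<in>J. 1 - (c i)\<^sup>2) \<le> (\<Prod>i\<in>J. 1 - (y i)\<^sup>2)"
proof -
  \<comment> \<open>A common upper limit below \<open>1\<close> for all the integrals; inserting \<open>0\<close> covers empty \<open>J\<close>.\<close>
  define \<tau> where "\<tau> = Max (insert 0 (c ` J \<union> y ` J))"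
  have \<tau>: "c i \<le> \<tau>" "y i \<le> \<tau>" if "i \<in> J" for i
    unfolding \<tau>_def using that J by (auto intro: Max_ge)
  have \<tau>1: "\<tau> < 1" using J c y by (auto simp: \<tau>_def)
  let ?f = "\<lambda>x \<theta>. 4 * \<theta> / (1 - \<theta>\<^sup>2)\<^sup>2 * (ln (max x \<theta>) - ln \<theta>)"
  have int: "((\<lambda>\<theta>. \<Sum>i\<in>J. ?f (x i) \<theta>) has_integral (\<Sum>i\<in>J. - ln (1 - (x i)\<^sup>2))) {0..\<tau>}"
    if "\<And>i. i \<in> J \<Longrightarrow> 0 \<le> x i \<and> x i \<le> \<tau>" for x
    using that \<tau>1 J by (intro has_integral_sum has_integral_minus_ln_one_minus_square) auto
  have "(\<Sum>i\<in>J. - ln (1 - (y i)\<^sup>2)) \<le> (\<Sum>i\<in>J. - ln (1 - (c i)\<^sup>2))"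
  proof (rule has_integral_le[OF int int])
    fix \<theta> assume \<theta>: "\<theta> \<in> {0..\<tau>}"
    show "(\<Sum>i\<in>J. ?f (y i) \<theta>) \<le> (\<Sum>i\<in>J. ?f (c i) \<theta>)"
    proof (cases "\<theta> = 0")
      case False
      then have \<theta>0: "0 < \<theta>" using \<theta> by simp
      then have "ln (\<Prod>i\<in>J. max (y i) \<theta>) \<le> ln (\<Prod>i\<in>J. max (c i) \<theta>)"
        by (intro ln_mono le prod_pos) auto
      then have "(\<Sum>i\<in>J. ln (max (y i) \<theta>)) \<le> (\<Sum>i\<in>J. ln (max (c i) \<theta>))"
        using \<theta>0 by (subst (asm) (1 2) ln_prod[OF J]) (auto simp: max_def)
      then have "(\<Sum>i\<in>J. ln (max (y i) \<theta>) - ln \<theta>) \<le> (\<Sum>i\<in>J. ln (max (c i) \<theta>) - ln \<theta>)"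
        by (simp add: sum_subtractf)
      then show ?thesis
        using \<theta>0 unfolding sum_distrib_left[symmetric] by (intro mult_left_mono) auto
    qed auto
  qed (use c y \<tau> in auto)
  then have "(\<Sum>i\<in>J. ln (1 - (c i)\<^sup>2)) \<le> (\<Sum>i\<in>J. ln (1 - (y i)\<^sup>2))"
    by (simp add: sum_negf)
  moreover have pos: "0 < 1 - (x i)\<^sup>2" if "i \<in> J" "\<And>i. i \<in> J \<Longrightarrow> 0 \<le> x i \<and> x i < 1"
    for x :: "'i \<Rightarrow> real" and i
    using that(2)[OF that(1)] by (simp add: power_less_one_iff)
  ultimately have "ln (\<Prod>i\<in>J. 1 - (c i)\<^sup>2) \<le> ln (\<Prod>i\<in>J. 1 - (y i)\<^sup>2)"
    using c y pos[of _ c] pos[of _ y] by (subst (1 2) ln_prod[OF J]) force+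
  moreover have "0 < (\<Prod>i\<in>J. 1 - (c i)\<^sup>2)" "0 < (\<Prod>i\<in>J. 1 - (y i)\<^sup>2)"
    using c y pos[of _ c] pos[of _ y] by (auto intro!: prod_pos)
  ultimately show ?thesis by simp
qed


section \<open>Powers as integrals of logarithms\<close>

definition power_kernel :: "real \<Rightarrow> real \<Rightarrow> real \<Rightarrow> real" where
  "power_kernel p t s = indicator {0<..} s * (s powr (p - 1) * (t / s - ln (1 + t / s)))"

text \<open>
  Makes \<open>power_kernel p 1 s\<close> of order \<open>s powr (p - 3)\<close> at infinity, which is integrable as \<open>p < 2\<close>.
\<close>

lemma ln_one_plus_ge_quadratic: "x - x\<^sup>2 / 2 \<le> ln (1 + x)" if "0 \<le> x" for x :: real
proof -
  let ?g = "\<lambda>x::real. ln (1 + x) - x + x\<^sup>2 / 2"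
  have "?g 0 \<le> ?g x"
  proof (rule DERIV_nonneg_imp_nondecreasing[OF that])
    fix z :: real assume z: "0 \<le> z" "z \<le> x"
    have "(?g has_real_derivative 1 / (1 + z) - 1 + z) (at z)"
      using z by (auto intro!: derivative_eq_intros)
    moreover have "0 \<le> 1 / (1 + z) - 1 + z" using z by (simp add: field_simps)
    ultimately show "\<exists>d. (?g has_real_derivative d) (at z) \<and> 0 \<le> d" by blast
  qed
  then show ?thesis by simp
qed

lemma power_kernel_nonneg: "0 \<le> t \<Longrightarrow> 0 \<le> power_kernel p t s"
  using ln_add_one_self_le_self[of "t / s"] by (auto simp: power_kernel_def indicator_def)

text \<open>
  Near \<open>0\<close> the logarithm is dropped, which leaves \<open>s powr (p - 2)\<close>, integrable because \<open>1 < p\<close>. Near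
  infinity the linear terms cancel and leave the order \<open>s powr (p - 3)\<close>, integrable because \<open>p < 2\<close>.
\<close>

lemma integrable_power_kernel_1:
  assumes "1 < p" "p < 2"
  shows "integrable lborel (power_kernel p 1)"
proof -
  let ?h = "\<lambda>s::real. indicator {0..1} s * s powr (p - 2) + indicator {1..} s * s powr (p - 3)"
  have "set_integrable lebesgue {0..1} (\<lambda>s::real. s powr (p - 2))"
    using assms by (intro nonnegative_absolutely_integrable_1 integrable_on_powr_from_0) auto
  moreover have "set_integrable lebesgue {1..} (\<lambda>s::real. s powr (p - 3))"
    using assms has_integral_powr_to_inf[of "p - 3" 1]
    by (intro nonnegative_absolutely_integrable_1) (auto simp: integrable_on_def)
  ultimately have "integrable lebesgue ?h"
    unfolding set_integrable_def real_scaleR_def by (rule Bochner_Integration.integrable_add)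
  then have "integrable lborel ?h"
    by (subst (asm) integrable_completion) measurable
  then show ?thesis
  proof (rule Bochner_Integration.integrable_bound)
    show "power_kernel p 1 \<in> borel_measurable lborel" unfolding power_kernel_def by measurable
    have "power_kernel p 1 s \<le> ?h s" for s
    proof (cases "0 < s")
      case s: True
      show ?thesis
      proof (cases "s \<le> 1")
        case True
        have "power_kernel p 1 s \<le> s powr (p - 1) * (1 / s)"
          using s mult_left_mono[of "1 / s - ln (1 + 1 / s)" "1 / s" "s powr (p - 1)"]
          by (simp add: power_kernel_def)
        also have "\<dots> = s powr (p - 2)"
          using s powr_diff[of s "p - 1" 1] by simp
        also have "\<dots> \<le> ?h s" using s True by (simp add: indicator_def)
        finally show ?thesis .
      next
        case False
        have "1 / s - ln (1 + 1 / s) \<le> (1 / s)\<^sup>2 / 2"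
          using ln_one_plus_ge_quadratic[of "1 / s"] s by simp
        also have "\<dots> \<le> (1 / s)\<^sup>2" by simp
        finally have "power_kernel p 1 s \<le> s powr (p - 1) * (1 / s)\<^sup>2"
          using s by (auto simp: power_kernel_def intro!: mult_left_mono)
        also have "\<dots> = s powr (p - 3)"
          using s powr_diff[of s "p - 1" 2] by (simp add: power_divide)
        also have "\<dots> \<le> ?h s" using s False by (simp add: indicator_def)
        finally show ?thesis .
      qed
    qed (simp add: power_kernel_def)
    then show "AE s in lborel. norm (power_kernel p 1 s) \<le> norm (?h s)"
      using power_kernel_nonneg[of 1 p] by (intro AE_I2) (simp add: indicator_def)
  qed
qed

text \<open>
  The substitution \<open>s = t * x\<close> turns the kernel for \<open>t\<close> into \<open>t powr (p - 1)\<close> times the kernel for \<open>1\<close>.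
  The constant \<open>K\<close> is positive because \<open>ln (1 + x) < x\<close> for \<open>x > 0\<close>.
\<close>

lemma power_kernel_integral:
  assumes "1 < p" "p < 2"
  obtains K where "0 < K" "\<And>t. 0 \<le> t \<Longrightarrow> has_bochner_integral lborel (power_kernel p t) (K * t powr p)"
proof -
  define K where "K = integral\<^sup>L lborel (power_kernel p 1)"
  have K: "has_bochner_integral lborel (power_kernel p 1) K"
    unfolding K_def using integrable_power_kernel_1[OF assms] by (rule has_bochner_integral_integrable)
  have "0 < K"
  proof (rule ccontr)
    assume "\<not> 0 < K"
    moreover have "0 \<le> K" unfolding K_def by (intro Bochner_Integration.integral_nonneg) (simp add: power_kernel_nonneg)
    ultimately have "K = 0" by simp
    then have "AE s in lborel. power_kernel p 1 s = 0"
      using K integral_nonneg_eq_0_iff_AE[OF integrable_power_kernel_1[OF assms]]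
      by (simp add: K_def power_kernel_nonneg)
    moreover have "power_kernel p 1 s \<noteq> 0" if "0 < s" for s
      using ln_add_one_self_less_self[of "1 / s"] that
      by (auto simp: power_kernel_def)
    ultimately have "AE s in lborel. \<not> (0::real) < s" by (metis (mono_tags, lifting) eventually_mono)
    then have "emeasure lborel {0::real<..} = 0"
      by (subst (asm) AE_iff_measurable[of "{0::real<..}"]) auto
    moreover have "emeasure lborel {0<..(1::real)} \<le> emeasure lborel {0::real<..}"
      by (intro emeasure_mono) auto
    ultimately show False by simp
  qed
  moreover have "has_bochner_integral lborel (power_kernel p t) (K * t powr p)" if "0 \<le> t" for t
  proof (cases "t = 0")
    case True
    then have "power_kernel p t = (\<lambda>s. 0)" by (auto simp: power_kernel_def)
    with True show ?thesis by (simp add: has_bochner_integral_zero)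
  next
    case False
    with that have t: "0 < t" by simp
    have kernel: "power_kernel p t (0 + t * x) = t powr (p - 1) * power_kernel p 1 x" for x
      using t by (auto simp: power_kernel_def indicator_def powr_mult zero_less_mult_iff)
    have const: "K * t powr p /\<^sub>R \<bar>t\<bar> = t powr (p - 1) * K"
      using t by (simp add: powr_diff divide_inverse)
    show ?thesis
      by (subst lborel_has_bochner_integral_real_affine_iff[OF False, of _ _ 0])
        (simp only: kernel const has_bochner_integral_mult_right[OF K])
  qed
  ultimately show thesis by (rule that)
qed

text \<open>
  In the integral representation of the two power sums, the terms linear in the arguments cancel by
  the equality of the sums, and the logarithms assemble to the logarithm of a product.
\<close>

lemma sum_powr_le_open:
  fixes x y :: "'i \<Rightarrow> real"
  assumes J: "finite J" and p: "1 < p" "p < 2"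
    and x: "\<And>j. j \<in> J \<Longrightarrow> 0 \<le> x j" and y: "\<And>j. j \<in> J \<Longrightarrow> 0 \<le> y j"
    and tr: "(\<Sum>j\<in>J. x j) = (\<Sum>j\<in>J. y j)"
    and le: "\<And>s. 0 < s \<Longrightarrow> (\<Prod>j\<in>J. s + x j) \<le> (\<Prod>j\<in>J. s + y j)"
  shows "(\<Sum>j\<in>J. y j powr p) \<le> (\<Sum>j\<in>J. x j powr p)"
proof -
  obtain K where K: "0 < K"
    "\<And>t. 0 \<le> t \<Longrightarrow> has_bochner_integral lborel (power_kernel p t) (K * t powr p)"
    using power_kernel_integral[OF p] by blast
  have int: "has_bochner_integral lborel (\<lambda>s. \<Sum>j\<in>J. power_kernel p (z j) s) (\<Sum>j\<in>J. K * z j powr p)"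
    if "\<And>j. j \<in> J \<Longrightarrow> 0 \<le> z j" for z
    using that by (intro has_bochner_integral_sum K)
  have "(\<Sum>j\<in>J. power_kernel p (y j) s) \<le> (\<Sum>j\<in>J. power_kernel p (x j) s)" for s
  proof (cases "0 < s")
    case True
    have eq: "(\<Sum>j\<in>J. power_kernel p (z j) s) =
        s powr (p - 1) * ((\<Sum>j\<in>J. z j) / s - (ln (\<Prod>j\<in>J. s + z j) - real (card J) * ln s))"
      if "\<And>j. j \<in> J \<Longrightarrow> 0 \<le> z j" for z
    proof -
      have "ln (\<Prod>j\<in>J. s + z j) = (\<Sum>j\<in>J. ln (s + z j))"
        using add_pos_nonneg[OF True that] by (intro ln_prod J) (simp add: less_imp_neq[THEN not_sym])
      moreover have "ln (1 + z j / s) = ln (s + z j) - ln s" if "j \<in> J" for j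
      proof -
        have "1 + z j / s = (s + z j) / s" using True by (simp add: field_simps)
        then show ?thesis using True \<open>\<And>j. j \<in> J \<Longrightarrow> 0 \<le> z j\<close>[OF that]
          by (simp add: ln_div add_pos_nonneg)
      qed
      ultimately show ?thesis
        using True by (simp add: power_kernel_def sum_distrib_left[symmetric] sum_subtractf
            sum_divide_distrib)
    qed
    have "ln (\<Prod>j\<in>J. s + x j) \<le> ln (\<Prod>j\<in>J. s + y j)"
      using x y True by (intro ln_mono le prod_pos) (auto simp: add_pos_nonneg)
    then show ?thesis
      using x y tr by (simp add: eq mult_left_mono)
  qed (simp add: power_kernel_def)
  then have "(\<Sum>j\<in>J. K * y j powr p) \<le> (\<Sum>j\<in>J. K * x j powr p)"
    using int[of x, OF x] int[of y, OF y]
      integral_mono[of lborel "\<lambda>s. \<Sum>j\<in>J. power_kernel p (y j) s" "\<lambda>s. \<Sum>j\<in>J. power_kernel p (x j) s"]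
    unfolding has_bochner_integral_iff by simp
  then show ?thesis using K(1) by (simp add: sum_distrib_left[symmetric])
qed

text \<open>
  The kernel integral diverges for \<open>p = 1\<close> and \<open>p = 2\<close>. These cases are limits of the others: for
  \<open>t > 0\<close> the function \<open>q \<mapsto> t powr q\<close> is continuous, and for \<open>t = 0\<close> it is constantly \<open>0\<close>.
\<close>

lemma sum_powr_le:
  fixes x y :: "'i \<Rightarrow> real"
  assumes J: "finite J" and p: "1 \<le> p" "p \<le> 2"
    and x: "\<And>j. j \<in> J \<Longrightarrow> 0 \<le> x j" and y: "\<And>j. j \<in> J \<Longrightarrow> 0 \<le> y j"
    and tr: "(\<Sum>j\<in>J. x j) = (\<Sum>j\<in>J. y j)"
    and le: "\<And>s. 0 < s \<Longrightarrow> (\<Prod>j\<in>J. s + x j) \<le> (\<Prod>j\<in>J. s + y j)"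
  shows "(\<Sum>j\<in>J. y j powr p) \<le> (\<Sum>j\<in>J. x j powr p)"
proof -
  let ?g = "\<lambda>q. (\<Sum>j\<in>J. x j powr q) - (\<Sum>j\<in>J. y j powr q)"
  have cont_powr: "continuous_on UNIV (\<lambda>q. a powr q)" for a :: real
    by (cases "a = 0") (auto intro!: continuous_intros)
  have "continuous_on (closure {1<..<2}) ?g"
    by (intro continuous_intros continuous_on_subset[OF cont_powr]) auto
  moreover have "p \<in> closure {1<..<2}" using p by simp
  moreover have "0 \<le> ?g q" if "q \<in> {1<..<2}" for q
    using sum_powr_le_open[OF J _ _ x y tr le, of q] that by simp
  ultimately have "0 \<le> ?g p" by (rule continuous_ge_on_closure)
  then show ?thesis by simp
qed

section \<open>Unitary diagonalization of Hermitian matrices\<close>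

lemma mat_adjoint_dim [simp]:
  "dim_row (mat_adjoint A) = dim_col A" "dim_col (mat_adjoint A) = dim_row A"
  by (auto simp: mat_adjoint_def)

lemma mat_adjoint_index [simp]:
  "i < dim_col A \<Longrightarrow> j < dim_row A \<Longrightarrow> mat_adjoint A $$ (i, j) = conjugate (A $$ (j, i))"
  by (simp add: mat_adjoint_def mat_of_rows_index)

lemma mat_adjoint_mult:
  fixes A B :: "complex mat"
  assumes "A \<in> carrier_mat n m" "B \<in> carrier_mat m k"
  shows "mat_adjoint (A * B) = mat_adjoint B * mat_adjoint A"
  using assms by (intro eq_matI) (auto simp: scalar_prod_def mult.commute intro!: sum.cong)

lemma mat_adjoint_adjoint [simp]: "mat_adjoint (mat_adjoint (A :: complex mat)) = A"
  by (intro eq_matI) auto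

lemma mat_adjoint_one [simp]: "mat_adjoint (1\<^sub>m n :: complex mat) = 1\<^sub>m n"
  by (intro eq_matI) auto

lemma mat_adjoint_mat_diag_real [simp]:
  "mat_adjoint (mat_diag n (\<lambda>i. complex_of_real (d i))) = mat_diag n (\<lambda>i. complex_of_real (d i))"
  by (intro eq_matI) (auto simp: mat_diag_def)

text \<open>
  Block matrices carry the induction step of the spectral theorem.
\<close>

lemma mat_adjoint_four_block:
  fixes A B C D :: "complex mat"
  assumes "A \<in> carrier_mat p q" "B \<in> carrier_mat p r" "C \<in> carrier_mat s q" "D \<in> carrier_mat s r"
  shows "mat_adjoint (four_block_mat A B C D) =
    four_block_mat (mat_adjoint A) (mat_adjoint C) (mat_adjoint B) (mat_adjoint D)"
  using assms by (intro eq_matI) auto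

lemma mult_block_diag:
  fixes A A' B B' :: "complex mat"
  assumes A: "A \<in> carrier_mat p p" "A' \<in> carrier_mat p p"
    and B: "B \<in> carrier_mat q q" "B' \<in> carrier_mat q q"
  shows "four_block_mat A (0\<^sub>m p q) (0\<^sub>m q p) B * four_block_mat A' (0\<^sub>m p q) (0\<^sub>m q p) B' =
    four_block_mat (A * A') (0\<^sub>m p q) (0\<^sub>m q p) (B * B')"
proof -
  have "A * 0\<^sub>m p q + 0\<^sub>m p q * B' = 0\<^sub>m p q" "0\<^sub>m q p * A' + B * 0\<^sub>m q p = 0\<^sub>m q p"
    "A * A' + 0\<^sub>m p q * 0\<^sub>m q p = A * A'" "0\<^sub>m q p * 0\<^sub>m p q + B * B' = B * B'"
    using A B mult_carrier_mat[OF A] mult_carrier_mat[OF B] by simp_all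
  then show ?thesis
    by (subst mult_four_block_mat[OF A(1) zero_carrier_mat zero_carrier_mat B(1) A(2) zero_carrier_mat zero_carrier_mat B(2)])
       (simp only:)
qed

lemma unitary_right_inverse:
  assumes "U \<in> carrier_mat n n" "mat_adjoint U * U = 1\<^sub>m n"
  shows "U * mat_adjoint U = (1\<^sub>m n :: complex mat)"
  using assms mat_mult_left_right_inverse[OF mat_adjoint_carrier[OF assms(1)]] by auto

text \<open>
  Gram--Schmidt applied to a basis that starts with \<open>v\<close> keeps \<open>v\<close> as first vector; it remains to
  normalize the columns.
\<close>

lemma unitary_completion:
  fixes v :: "complex vec"
  assumes v: "v \<in> carrier_vec n" "v \<noteq> 0\<^sub>v n"
  obtains W k where "W \<in> carrier_mat n n" "mat_adjoint W * W = 1\<^sub>m n" "col W 0 = k \<cdot>\<^sub>v v"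
proof -
  interpret cof_vec_space n "TYPE(complex)" .
  define b where "b = basis_completion v"
  define ws where "ws = gram_schmidt n b"
  note b = basis_completion[OF v, folded b_def]
  have n: "0 < n" using v by (cases n) auto
  obtain vs where bv: "b = v # vs" using b(6,7) n by (cases b) auto
  have ws: "set ws \<subseteq> carrier_vec n" "corthogonal ws" "length ws = n"
    using gram_schmidt_result[OF b(2,4,5), of ws] b(6) ws_def by auto
  have "hd ws = v" using gram_schmidt_hd[OF v(1), of vs] by (simp add: ws_def bv)
  then have ws0: "ws ! 0 = v" using ws(3) n by (cases ws) auto
  have wsc: "ws ! i \<in> carrier_vec n" if "i < n" for i using ws that by auto
  define r where "r i = sqrt (Re (ws ! i \<bullet>c ws ! i))" for i
  have self: "ws ! i \<bullet>c ws ! i = of_real (r i) * of_real (r i) \<and> r i \<noteq> 0" if i: "i < n" for i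
  proof -
    have "0 \<le> ws ! i \<bullet>c ws ! i" by (rule conjugate_square_ge_0_vec)
    moreover have "ws ! i \<bullet>c ws ! i \<noteq> 0" using corthogonalD[OF ws(2), of i i] ws(3) i by auto
    ultimately have "0 < Re (ws ! i \<bullet>c ws ! i)" "Im (ws ! i \<bullet>c ws ! i) = 0"
      by (auto simp: less_eq_complex_def complex_eq_iff)
    then show ?thesis
      unfolding r_def of_real_mult[symmetric] by (simp add: complex_eq_iff)
  qed
  define W where "W = mat n n (\<lambda>(i, j). ws ! j $ i / of_real (r j))"
  have W: "W \<in> carrier_mat n n" by (simp add: W_def)
  have "mat_adjoint W * W = 1\<^sub>m n"
  proof (rule eq_matI)
    fix i j assume "i < dim_row (1\<^sub>m n :: complex mat)" "j < dim_col (1\<^sub>m n :: complex mat)"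
    then have ij: "i < n" "j < n" by auto
    have "(mat_adjoint W * W) $$ (i, j) =
        (\<Sum>k<n. cnj (ws ! i $ k) / of_real (r i) * (ws ! j $ k / of_real (r j)))"
      using ij W by (simp add: scalar_prod_def W_def lessThan_atLeast0)
    also have "\<dots> = (ws ! j \<bullet>c ws ! i) / (of_real (r i) * of_real (r j))"
      using wsc[OF ij(1)] by (simp add: scalar_prod_def sum_divide_distrib lessThan_atLeast0 mult.commute)
    also have "\<dots> = 1\<^sub>m n $$ (i, j)"
      using corthogonalD[OF ws(2), of j i] ws(3) ij self[of i] by (cases "i = j") auto
    finally show "(mat_adjoint W * W) $$ (i, j) = 1\<^sub>m n $$ (i, j)" .
  qed (use W in auto)
  moreover have "col W 0 = (1 / of_real (r 0)) \<cdot>\<^sub>v v"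
    using n v by (intro eq_vecI) (auto simp: W_def ws0)
  ultimately show thesis using that W by blast
qed

text \<open>
  Induction on the list of eigenvalues. Conjugating by a unitary matrix whose first column is an
  eigenvector puts \<open>e\<close> followed by zeros into the first column, hence, by hermiticity, also into the
  first row, and splits off a Hermitian block of smaller size. The eigenvalues appear on the diagonal
  in the order in which the list gives them, so that any order can be prescribed.
\<close>

lemma hermitian_schur:
  fixes X :: "complex mat"
  assumes "X \<in> carrier_mat n n" "mat_adjoint X = X" "char_poly X = (\<Prod>e\<leftarrow>es. [:- e, 1:])"
  shows "\<exists>U \<in> carrier_mat n n. mat_adjoint U * U = 1\<^sub>m n \<and>
    X = U * mat_diag n (\<lambda>i. es ! i) * mat_adjoint U \<and> (\<forall>e \<in> set es. Im e = 0)"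
  using assms
proof (induction es arbitrary: n X)
  case Nil
  then have "n = 0" using degree_monic_char_poly[OF Nil(1)] by simp
  then show ?case using Nil by (intro bexI[of _ "1\<^sub>m 0"]) auto
next
  case (Cons e es)
  note X = Cons.prems(1) and herm = Cons.prems(2) and cp = Cons.prems(3)
  have "eigenvalue X e" unfolding eigenvalue_root_char_poly[OF X] cp by simp
  then obtain v where v: "v \<in> carrier_vec n" "v \<noteq> 0\<^sub>v n" and Xv: "X *\<^sub>v v = e \<cdot>\<^sub>v v"
    using X unfolding eigenvalue_def eigenvector_def by auto
  obtain m where n: "n = Suc m" using v by (cases n) auto
  obtain W k where W: "W \<in> carrier_mat n n" and WW: "mat_adjoint W * W = 1\<^sub>m n"
    and W0: "col W 0 = k \<cdot>\<^sub>v v" using unitary_completion[OF v] by blast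
  have W': "mat_adjoint W \<in> carrier_mat n n" using W by (rule mat_adjoint_carrier)
  have WW2: "W * mat_adjoint W = 1\<^sub>m n" using unitary_right_inverse[OF W WW] .
  note assoc = assoc_mult_mat[of _ n n _ n _ n]
  define Y where "Y = mat_adjoint W * X * W"
  have Y: "Y \<in> carrier_mat n n" using W W' X by (auto simp: Y_def)
  have YX: "X = W * Y * mat_adjoint W"
  proof -
    have "W * Y * mat_adjoint W = (W * mat_adjoint W) * X * (W * mat_adjoint W)"
      using W W' X by (simp add: Y_def assoc)
    then show ?thesis using X by (simp add: WW2)
  qed
  have Yherm: "mat_adjoint Y = Y"
    using W W' X herm by (simp add: Y_def mat_adjoint_mult[of _ n n _ n] assoc)
  have "X *\<^sub>v col W 0 = e \<cdot>\<^sub>v col W 0"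
    using X v by (simp add: W0 mult_mat_vec Xv smult_smult_assoc mult.commute)
  moreover have "col (X * W) 0 = X *\<^sub>v col W 0"
    using W X n by (intro col_mult2[of _ n n _ n]) auto
  moreover have "col Y 0 = mat_adjoint W *\<^sub>v col (X * W) 0"
    unfolding Y_def assoc[OF W' X W] using W W' X n by (intro col_mult2[of _ n n _ n]) auto
  ultimately have "col Y 0 = mat_adjoint W *\<^sub>v (e \<cdot>\<^sub>v col W 0)" by simp
  also have "\<dots> = e \<cdot>\<^sub>v col (1\<^sub>m n) 0"
    using col_mult2[OF W' W, of 0] mult_mat_vec[OF W' col_dim[of W 0, unfolded carrier_matD(1)[OF W]], of e] n
    by (simp add: WW)
  finally have colY: "col Y 0 = e \<cdot>\<^sub>v col (1\<^sub>m n) 0" .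
  have Y0: "Y $$ (i, 0) = (if i = 0 then e else 0)" if "i < n" for i
    using arg_cong[OF colY, of "\<lambda>u. u $ i"] that Y n by simp
  have Yconj: "Y $$ (i, j) = cnj (Y $$ (j, i))" if "i < n" "j < n" for i j
    using that Y arg_cong[OF Yherm, of "\<lambda>M. M $$ (i, j)"] by simp
  have Y0': "Y $$ (0, j) = (if j = 0 then e else 0)" if "j < n" for j
    using Yconj[of 0 j] Yconj[of 0 0] Y0[of j] Y0[of 0] that n by (cases "j = 0") auto
  have e: "Im e = 0" using Yconj[of 0 0] Y0[of 0] n by (simp add: complex_eq_iff)
  define E where "E = mat 1 1 (\<lambda>_. e)"
  define Z where "Z = mat m m (\<lambda>(i, j). Y $$ (Suc i, Suc j))"
  have E: "E \<in> carrier_mat 1 1" and Z: "Z \<in> carrier_mat m m" by (auto simp: E_def Z_def)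
  have Yb: "Y = four_block_mat E (0\<^sub>m 1 m) (0\<^sub>m m 1) Z"
    using Y n Y0 Y0' by (intro eq_matI) (auto simp: E_def Z_def)
  have "similar_mat X Y"
    using X Y W W' WW WW2 YX by (intro similar_matI[of _ _ W "mat_adjoint W" n]) auto
  then have "char_poly E * char_poly Z = [:- e, 1:] * (\<Prod>e\<leftarrow>es. [:- e, 1:])"
    using char_poly_similar[of X Y] cp char_poly_four_block_zeros_col[OF E _ Z, of "0\<^sub>m 1 m"]
    by (simp add: Yb)
  moreover have "char_poly E = [:- e, 1:]"
    by (subst char_poly_upper_triangular[OF E]) (auto simp: E_def diag_mat_def)
  ultimately have eq: "[:- e, 1:] * char_poly Z = [:- e, 1:] * (\<Prod>e\<leftarrow>es. [:- e, 1:])"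
    by (simp only:)
  have "[:- e, 1:] \<noteq> 0" by simp
  from eq[unfolded mult_left_cancel[OF this]]
  have cpZ: "char_poly Z = (\<Prod>e\<leftarrow>es. [:- e, 1:])" .
  have "mat_adjoint Z = Z"
  proof (rule eq_matI)
    fix i j assume "i < dim_row Z" "j < dim_col Z"
    then have ij: "i < m" "j < m" using Z by auto
    then have "mat_adjoint Z $$ (i, j) = cnj (Y $$ (Suc j, Suc i))" by (simp add: Z_def)
    also have "\<dots> = Y $$ (Suc i, Suc j)" using ij n by (intro Yconj[symmetric]) auto
    also have "\<dots> = Z $$ (i, j)" using ij by (simp add: Z_def)
    finally show "mat_adjoint Z $$ (i, j) = Z $$ (i, j)" .
  qed (use Z in auto)
  from Cons.IH[OF Z this cpZ] obtain U where U1: "U \<in> carrier_mat m m"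
    and U2: "mat_adjoint U * U = 1\<^sub>m m \<and>
      Z = U * mat_diag m (\<lambda>i. es ! i) * mat_adjoint U \<and> (\<forall>e \<in> set es. Im e = 0)"
    by (rule bexE)
  note U = U1 U2[THEN conjunct1]
  note ZU = U2[THEN conjunct2, THEN conjunct1] and es = U2[THEN conjunct2, THEN conjunct2]
  have U': "mat_adjoint U \<in> carrier_mat m m" using U(1) by (rule mat_adjoint_carrier)
  define F where "F = four_block_mat (1\<^sub>m 1) (0\<^sub>m 1 m) (0\<^sub>m m 1) U"
  have F: "F \<in> carrier_mat n n" using U n by (auto simp: F_def)
  have z: "mat_adjoint (0\<^sub>m p q :: complex mat) = 0\<^sub>m q p" for p q by (intro eq_matI) auto
  have F_adj: "mat_adjoint F = four_block_mat (1\<^sub>m 1) (0\<^sub>m 1 m) (0\<^sub>m m 1) (mat_adjoint U)"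
    unfolding F_def using U by (subst mat_adjoint_four_block[of _ 1 1 _ m _ m]) (auto simp: z)
  have F': "mat_adjoint F \<in> carrier_mat n n" using F by (rule mat_adjoint_carrier)
  have FF: "mat_adjoint F * F = 1\<^sub>m n"
    unfolding F_adj unfolding F_def mult_block_diag[OF one_carrier_mat one_carrier_mat U' U(1)] U(2) n
    by simp
  define D where "D = mat_diag n (\<lambda>i. (e # es) ! i)"
  have D: "D \<in> carrier_mat n n" by (simp add: D_def)
  have Db: "D = four_block_mat E (0\<^sub>m 1 m) (0\<^sub>m m 1) (mat_diag m (\<lambda>i. es ! i))"
    unfolding D_def using n by (intro eq_matI) (auto simp: mat_diag_def E_def)
  have dm: "mat_diag m (\<lambda>i. es ! i) \<in> carrier_mat m m" by simp
  have "F * D = four_block_mat E (0\<^sub>m 1 m) (0\<^sub>m m 1) (U * mat_diag m (\<lambda>i. es ! i))"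
    unfolding F_def Db mult_block_diag[OF one_carrier_mat E U(1) dm] left_mult_one_mat[OF E] ..
  then have "F * D * mat_adjoint F = four_block_mat E (0\<^sub>m 1 m) (0\<^sub>m m 1) (U * mat_diag m (\<lambda>i. es ! i) * mat_adjoint U)"
    by (simp only: F_adj mult_block_diag[OF E one_carrier_mat mult_carrier_mat[OF U(1) dm] U'] right_mult_one_mat[OF E])
  then have YF: "Y = F * D * mat_adjoint F" unfolding Yb ZU[symmetric] by (rule sym)
  have "mat_adjoint (W * F) * (W * F) = mat_adjoint F * (mat_adjoint W * W) * F"
    using W W' F F' by (simp add: mat_adjoint_mult[of _ n n _ n] assoc)
  then have "mat_adjoint (W * F) * (W * F) = 1\<^sub>m n" using F F' by (simp add: WW FF)
  moreover have "X = W * F * mat_diag n (\<lambda>i. (e # es) ! i) * mat_adjoint (W * F)"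
    unfolding D_def[symmetric]
    using W W' F F' D unfolding YX YF
    by (simp add: mat_adjoint_mult[of _ n n _ n] assoc mult_carrier_mat[of _ n n _ n])
  ultimately show ?case
    using mult_carrier_mat[OF W F] e es by (intro bexI[of _ "W * F"] conjI) simp_all
qed

section \<open>Diagonal congruences, the spectral theorem and Weyl monotonicity\<close>

text \<open>
  For unitary \<open>S\<close> this is a matrix with eigenvalues \<open>d\<close>. The matrices to be compared below, however,
  share one \<open>S\<close> that is only invertible, so unitarity is kept as a separate hypothesis.
\<close>

definition congr_diag :: "nat \<Rightarrow> complex mat \<Rightarrow> (nat \<Rightarrow> real) \<Rightarrow> complex mat" where
  "congr_diag n S d = S * mat_diag n (\<lambda>i. of_real (d i)) * mat_adjoint S"

lemma mat_diag_cong: "(\<And>i. i < n \<Longrightarrow> f i = g i) \<Longrightarrow> mat_diag n f = mat_diag n g"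
  by (intro eq_matI) (auto simp: mat_diag_def)

context
  fixes n :: nat and S :: "complex mat"
  assumes S: "S \<in> carrier_mat n n"
begin

lemma congr_diag_carrier: "congr_diag n S d \<in> carrier_mat n n"
  unfolding congr_diag_def
  by (intro mult_carrier_mat[of _ n n _ n] S mat_adjoint_carrier[OF S] mat_diag_dim)

lemma congr_diag_add: "congr_diag n S d + congr_diag n S e = congr_diag n S (\<lambda>i. d i + e i)"
proof -
  let ?D = "\<lambda>d. mat_diag n (\<lambda>i. complex_of_real (d i))"
  have "?D (\<lambda>i. d i + e i) = ?D d + ?D e" by (intro eq_matI) (auto simp: mat_diag_def)
  then show ?thesis
    using S mat_adjoint_carrier[OF S]
    by (simp add: congr_diag_def add_mult_distrib_mat[of _ n n] mult_add_distrib_mat[of _ n n _ n])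
qed

lemma congr_diag_minus: "congr_diag n S d - congr_diag n S e = congr_diag n S (\<lambda>i. d i - e i)"
proof -
  let ?D = "\<lambda>d. mat_diag n (\<lambda>i. complex_of_real (d i))"
  have "?D (\<lambda>i. d i - e i) = ?D d - ?D e" by (intro eq_matI) (auto simp: mat_diag_def)
  then show ?thesis
    using S mat_adjoint_carrier[OF S]
    by (simp add: congr_diag_def minus_mult_distrib_mat[of _ n n] mult_minus_distrib_mat[of _ n n _ n])
qed

lemma congr_diag_hermitian: "mat_adjoint (congr_diag n S d) = congr_diag n S d"
proof -
  let ?D = "mat_diag n (\<lambda>i. complex_of_real (d i))"
  have "mat_adjoint (S * ?D * mat_adjoint S) = S * (?D * mat_adjoint S)"
    using S mat_adjoint_carrier[OF S]
    by (simp add: mat_adjoint_mult[of _ n n _ n] mult_carrier_mat[of _ n n _ n])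
  then show ?thesis
    using S mat_adjoint_carrier[OF S]
    by (simp add: congr_diag_def assoc_mult_mat[of _ n n _ n _ n])
qed

lemma det_congr_diag:
  "det (congr_diag n S d) = det S * det (mat_adjoint S) * of_real (\<Prod>i<n. d i)"
proof -
  let ?D = "mat_diag n (\<lambda>i. complex_of_real (d i))"
  have "det ?D = prod_list (diag_mat ?D)"
    by (rule det_upper_triangular[of _ n]) (auto simp: mat_diag_def)
  also have "\<dots> = of_real (\<Prod>i<n. d i)"
    by (simp add: prod_list_diag_prod mat_diag_def lessThan_atLeast0)
  finally show ?thesis
    using S mat_adjoint_carrier[OF S] by (simp add: congr_diag_def det_mult[of _ n])
qed

lemma congr_diag_quadratic_form:
  assumes v: "v \<in> carrier_vec n"
  shows "(congr_diag n S d *\<^sub>v v) \<bullet>c v = of_real (\<Sum>i<n. d i * (cmod ((mat_adjoint S *\<^sub>v v) $ i))\<^sup>2)"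
proof -
  note S' = mat_adjoint_carrier[OF S]
  define w where "w = mat_adjoint S *\<^sub>v v"
  have w: "w \<in> carrier_vec n" using S' v by (auto simp: w_def)
  let ?D = "mat_diag n (\<lambda>i. complex_of_real (d i))"
  have Dw: "?D *\<^sub>v w = vec n (\<lambda>i. of_real (d i) * w $ i)"
    using w by (intro eq_vecI)
      (auto simp: mat_diag_def scalar_prod_def if_distrib[of "\<lambda>x. x * _"] cong: if_cong)
  have adj: "(S *\<^sub>v u) \<bullet>c v = u \<bullet>c w" if u: "u \<in> carrier_vec n" for u
  proof -
    have "(S *\<^sub>v u) \<bullet>c v = (\<Sum>i<n. \<Sum>j<n. S $$ (i, j) * u $ j * cnj (v $ i))"
      using S u v by (simp add: scalar_prod_def sum_distrib_right lessThan_atLeast0)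
    also have "\<dots> = (\<Sum>j<n. \<Sum>i<n. S $$ (i, j) * u $ j * cnj (v $ i))" by (rule sum.swap)
    also have "\<dots> = u \<bullet>c w"
      using S u v by (simp add: w_def scalar_prod_def sum_distrib_left lessThan_atLeast0 mult_ac)
    finally show ?thesis .
  qed
  have "congr_diag n S d *\<^sub>v v = S *\<^sub>v (?D *\<^sub>v w)"
    using S S' v w by (simp add: congr_diag_def w_def assoc_mult_mat_vec[of _ n n _ n])
  then have "(congr_diag n S d *\<^sub>v v) \<bullet>c v = (?D *\<^sub>v w) \<bullet>c w"
    using adj[of "?D *\<^sub>v w"] by (simp add: Dw)
  also have "\<dots> = (\<Sum>i<n. of_real (d i) * (w $ i * cnj (w $ i)))"
    using w by (simp add: Dw scalar_prod_def lessThan_atLeast0 mult_ac)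
  also have "\<dots> = of_real (\<Sum>i<n. d i * (cmod (w $ i))\<^sup>2)"
    by (simp only: of_real_sum of_real_mult complex_norm_square)
  finally show ?thesis by (simp add: w_def)
qed

end

lemma unitary_diag_iff:
  assumes "X \<in> carrier_mat n n"
  shows "unitary_diag X U d \<longleftrightarrow>
    U \<in> carrier_mat n n \<and> mat_adjoint U * U = 1\<^sub>m n \<and> X = congr_diag n U d"
proof -
  have "dim_row X = n" using assms by simp
  then show ?thesis
    unfolding unitary_diag_def unitary_mat_def congr_diag_def carrier_mat_def square_mat.simps by auto
qed

lemma unitary_diagD:
  assumes "X \<in> carrier_mat n n" "unitary_diag X U d"
  shows "U \<in> carrier_mat n n" "mat_adjoint U * U = 1\<^sub>m n" "X = congr_diag n U d"
  using assms(2) unfolding unitary_diag_iff[OF assms(1)] by blast+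

text \<open>
  Parseval's identity: the quadratic form of \<open>congr_diag\<close> with all entries \<open>1\<close>.
\<close>

lemma sum_norm_unitary:
  assumes "U \<in> carrier_mat n n" "mat_adjoint U * U = 1\<^sub>m n" "v \<in> carrier_vec n"
  shows "complex_of_real (\<Sum>i<n. (cmod ((mat_adjoint U *\<^sub>v v) $ i))\<^sup>2) = v \<bullet>c v"
proof -
  have "congr_diag n U (\<lambda>_. 1) = 1\<^sub>m n"
    using assms unitary_right_inverse[OF assms(1,2)] by (simp add: congr_diag_def)
  then show ?thesis
    using congr_diag_quadratic_form[OF assms(1,3), of "\<lambda>_. 1"] assms(3) by simp
qed

lemma char_poly_unitary_diag:
  assumes X: "X \<in> carrier_mat n n" and U: "unitary_diag X U d"
  shows "char_poly X = (\<Prod>e\<leftarrow>map (\<lambda>i. of_real (d i)) [0..<n]. [:- e, 1:])"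
proof -
  let ?D = "mat_diag n (\<lambda>i. complex_of_real (d i))"
  have "similar_mat X ?D"
    using U X unitary_right_inverse[of U n] mat_adjoint_carrier[of U n n]
    by (intro similar_matI[of _ _ U "mat_adjoint U" n])
       (auto simp: unitary_diag_iff[OF X] congr_diag_def)
  moreover have "char_poly ?D = (\<Prod>e\<leftarrow>map (\<lambda>i. of_real (d i)) [0..<n]. [:- e, 1:])"
    by (subst char_poly_upper_triangular[of _ n])
       (auto simp: mat_diag_def diag_mat_def intro!: arg_cong[of _ _ prod_list])
  ultimately show ?thesis using char_poly_similar by metis
qed

text \<open>
  A first diagonalization, with the eigenvalues in any order, shows that they are real. They can then
  be sorted, and a second one realizes the sorted order.
\<close>

lemma hermitian_unitary_diag:
  assumes X: "X \<in> carrier_mat n n" and herm: "mat_adjoint X = X"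
  obtains U d where "unitary_diag X U d" "\<And>i j. i \<le> j \<Longrightarrow> j < n \<Longrightarrow> d j \<le> d i"
proof -
  have ex: "\<exists>U. unitary_diag X U (\<lambda>i. Re (es ! i)) \<and> (\<forall>e\<in>set es. Im e = 0)"
    if es: "char_poly X = (\<Prod>e\<leftarrow>es. [:- e, 1:])" "length es = n" for es
  proof -
    obtain U where U: "U \<in> carrier_mat n n" "mat_adjoint U * U = 1\<^sub>m n"
      "X = U * mat_diag n (\<lambda>i. es ! i) * mat_adjoint U" and re: "\<forall>e\<in>set es. Im e = 0"
      using hermitian_schur[OF X herm es(1)] by blast
    have "mat_diag n (\<lambda>i. es ! i) = mat_diag n (\<lambda>i. of_real (Re (es ! i)))"
      using re es(2) by (intro mat_diag_cong) (auto simp: complex_eq_iff)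
    with U re show ?thesis unfolding unitary_diag_iff[OF X] congr_diag_def by auto
  qed
  obtain es where es: "char_poly X = (\<Prod>e\<leftarrow>es. [:- e, 1:])" "length es = n"
    using char_poly_factorized[OF X] by blast
  define rs where "rs = rev (sort (map Re es))"
  have "mset (map complex_of_real rs) = image_mset (\<lambda>e. of_real (Re e)) (mset es)"
    by (simp add: rs_def multiset.map_comp comp_def)
  also have "\<dots> = image_mset (\<lambda>e. e) (mset es)"
    using ex[OF es] by (intro image_mset_cong) (auto simp: complex_eq_iff)
  finally have "mset (map complex_of_real rs) = mset es" by simp
  then have "mset (map (\<lambda>e. [:- e, 1:]) (map complex_of_real rs)) = mset (map (\<lambda>e. [:- e, 1:]) es)"
    by (metis mset_map)
  then have cp: "char_poly X = (\<Prod>e\<leftarrow>map complex_of_real rs. [:- e, 1:])"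
    unfolding es(1) by (metis prod_mset_prod_list)
  have len: "length (map complex_of_real rs) = n" using es(2) by (simp add: rs_def)
  obtain U where U: "unitary_diag X U (\<lambda>i. Re (map complex_of_real rs ! i))"
    using ex[OF cp len] by blast
  have mono: "Re (map complex_of_real rs ! j) \<le> Re (map complex_of_real rs ! i)"
    if "i \<le> j" "j < n" for i j
  proof -
    have "sorted (rev rs)" by (simp add: rs_def)
    then have "rs ! j \<le> rs ! i" using that len by (intro sorted_rev_nth_mono) auto
    then show ?thesis using that len by simp
  qed
  show thesis by (rule that[OF U mono])
qed

text \<open>
  The first \<open>i + 1\<close> columns of \<open>U\<close> span a space that meets the orthogonal complement of the first \<open>i\<close>
  columns of \<open>V\<close> in some \<open>v \<noteq> 0\<close>. On \<open>v\<close> the form of \<open>x\<close> is at least \<open>x i\<close> and that of \<open>y\<close> at most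
  \<open>y i\<close> times the squared norm.
\<close>

lemma weyl_monotonicity:
  assumes U: "U \<in> carrier_mat n n" "mat_adjoint U * U = 1\<^sub>m n"
    and V: "V \<in> carrier_mat n n" "mat_adjoint V * V = 1\<^sub>m n"
    and x: "\<And>i j. i \<le> j \<Longrightarrow> j < n \<Longrightarrow> x j \<le> x i" and y: "\<And>i j. i \<le> j \<Longrightarrow> j < n \<Longrightarrow> y j \<le> y i"
    and le: "\<And>v. v \<in> carrier_vec n \<Longrightarrow>
      (\<Sum>j<n. x j * (cmod ((mat_adjoint U *\<^sub>v v) $ j))\<^sup>2) \<le> (\<Sum>j<n. y j * (cmod ((mat_adjoint V *\<^sub>v v) $ j))\<^sup>2)"
    and i: "i < n"
  shows "x i \<le> (y i :: real)"
proof -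
  note U' = mat_adjoint_carrier[OF U(1)] and V' = mat_adjoint_carrier[OF V(1)]
  define M where "M = mat_adjoint V * U"
  have M: "M \<in> carrier_mat n n" using U V' by (auto simp: M_def)
  \<comment> \<open>\<open>i\<close> linear equations in \<open>i + 1\<close> unknowns; the zero row makes the system square and singular.\<close>
  define N where "N = mat (Suc i) (Suc i) (\<lambda>(r, c). if r < i then M $$ (r, c) else 0)"
  have N: "N \<in> carrier_mat (Suc i) (Suc i)" by (simp add: N_def)
  have "transpose_mat N *\<^sub>v unit_vec (Suc i) i = 0\<^sub>v (Suc i)"
    by (intro eq_vecI) (auto simp: N_def scalar_prod_def unit_vec_def)
  moreover have "unit_vec (Suc i) i \<noteq> (0\<^sub>v (Suc i) :: complex vec)" by simp
  ultimately have "det (transpose_mat N) = 0"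
    using N by (subst det_0_iff_vec_prod_zero[of _ "Suc i"]) (auto intro!: exI[of _ "unit_vec (Suc i) i"])
  then have "det N = 0" using det_transpose[OF N] by simp
  then obtain z0 where z0: "z0 \<in> carrier_vec (Suc i)" "z0 \<noteq> 0\<^sub>v (Suc i)" "N *\<^sub>v z0 = 0\<^sub>v (Suc i)"
    using det_0_iff_vec_prod_zero[OF N] by blast
  define z where "z = vec n (\<lambda>j. if j \<le> i then z0 $ j else 0)"
  have z: "z \<in> carrier_vec n" by (simp add: z_def)
  define v where "v = U *\<^sub>v z"
  have v: "v \<in> carrier_vec n" using U z by (auto simp: v_def)
  have Uv: "mat_adjoint U *\<^sub>v v = z"
    using U U' z by (simp add: v_def assoc_mult_mat_vec[symmetric, of _ n n _ n])
  have Vv: "mat_adjoint V *\<^sub>v v = M *\<^sub>v z"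
    using U V' z by (simp add: v_def M_def assoc_mult_mat_vec[of _ n n _ n])
  have Mz: "(M *\<^sub>v z) $ r = 0" if r: "r < i" for r
  proof -
    have "(M *\<^sub>v z) $ r = (\<Sum>c<n. M $$ (r, c) * z $ c)"
      using M z r i by (simp add: scalar_prod_def lessThan_atLeast0)
    also have "\<dots> = (\<Sum>c<Suc i. M $$ (r, c) * z0 $ c)"
      using i by (intro sum.mono_neutral_cong_right) (auto simp: z_def)
    also have "\<dots> = (N *\<^sub>v z0) $ r"
      using z0(1) r by (simp add: N_def scalar_prod_def lessThan_atLeast0)
    finally show ?thesis using r unfolding z0(3) by simp
  qed
  define L where "L = (\<Sum>j<n. (cmod (z $ j))\<^sup>2)"
  have "complex_of_real L = complex_of_real (\<Sum>j<n. (cmod ((M *\<^sub>v z) $ j))\<^sup>2)"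
    using sum_norm_unitary[OF U v] sum_norm_unitary[OF V v] by (simp add: L_def Uv Vv)
  then have L: "L = (\<Sum>j<n. (cmod ((M *\<^sub>v z) $ j))\<^sup>2)" by (simp only: of_real_eq_iff)
  have "x i * L \<le> (\<Sum>j<n. x j * (cmod (z $ j))\<^sup>2)"
    unfolding L_def sum_distrib_left using x i
    by (intro sum_mono) (auto simp: z_def intro!: mult_right_mono)
  also have "\<dots> \<le> (\<Sum>j<n. y j * (cmod ((M *\<^sub>v z) $ j))\<^sup>2)"
    using le[OF v] by (simp add: Uv Vv)
  also have "\<dots> \<le> y i * L"
    unfolding L sum_distrib_left
  proof (intro sum_mono)
    fix j assume "j \<in> {..<n}"
    then show "y j * (cmod ((M *\<^sub>v z) $ j))\<^sup>2 \<le> y i * (cmod ((M *\<^sub>v z) $ j))\<^sup>2"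
      using y[of i j] Mz[of j] by (cases "j < i") (auto intro!: mult_right_mono)
  qed
  finally have "x i * L \<le> y i * L" .
  moreover have "0 < L"
  proof -
    obtain j where j: "j < Suc i" "z0 $ j \<noteq> 0"
      using z0(1,2) by (metis carrier_vecD eq_vecI index_zero_vec)
    then have "0 < (cmod (z $ j))\<^sup>2" "j < n" using i by (auto simp: z_def)
    then show ?thesis unfolding L_def by (intro sum_pos2[of _ j]) auto
  qed
  ultimately show ?thesis by simp
qed

lemma hermitian_quadratic_form:
  assumes X: "X \<in> carrier_mat n n" and U: "unitary_diag X U d" and v: "v \<in> carrier_vec n"
  shows "Re ((X *\<^sub>v v) \<bullet>c v) = (\<Sum>i<n. d i * (cmod ((mat_adjoint U *\<^sub>v v) $ i))\<^sup>2)"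
  using congr_diag_quadratic_form[OF unitary_diagD(1)[OF X U] v, of d]
  by (simp only: unitary_diagD(3)[OF X U, symmetric] Re_complex_of_real)

text \<open>
  The vector that \<open>S\<^sup>*\<close> maps to the \<open>i\<close>-th unit vector is a single test vector that reads off the
  \<open>i\<close>-th entry of every \<open>d\<close>.
\<close>

lemma congr_diag_coeff:
  assumes S: "S \<in> carrier_mat n n" and R: "R \<in> carrier_mat n n" "R * S = 1\<^sub>m n" and i: "i < n"
  shows "\<exists>v \<in> carrier_vec n. \<forall>d. Re ((congr_diag n S d *\<^sub>v v) \<bullet>c v) = d i"
proof -
  define v where "v = mat_adjoint R *\<^sub>v unit_vec n i"
  note R' = mat_adjoint_carrier[OF R(1)] and S' = mat_adjoint_carrier[OF S]
  have v: "v \<in> carrier_vec n" using R' by (simp add: v_def)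
  have "mat_adjoint S * mat_adjoint R = 1\<^sub>m n"
    using mat_adjoint_mult[OF R(1) S] R(2) by simp
  then have "mat_adjoint S *\<^sub>v v = unit_vec n i"
    using R' S' by (simp add: v_def assoc_mult_mat_vec[symmetric, of _ n n _ n])
  then have "Re ((congr_diag n S d *\<^sub>v v) \<bullet>c v) = (\<Sum>j<n. d j * (cmod (unit_vec n i $ j))\<^sup>2)" for d
    using congr_diag_quadratic_form[OF S v, of d] by simp
  also have "(\<Sum>j<n. d j * (cmod (unit_vec n i $ j))\<^sup>2) = (\<Sum>j<n. if j = i then d j else 0)" for d
    using i by (intro sum.cong) (auto simp: unit_vec_def)
  also have "(\<Sum>j<n. if j = i then d j else 0) = d i" for d :: "nat \<Rightarrow> real" using i by simp
  finally show ?thesis using v by blast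
qed

lemma pos_semidef_eigenvalues_nonneg:
  assumes X: "X \<in> carrier_mat n n" and psd: "pos_semidef X" and U: "unitary_diag X U d" and i: "i < n"
  shows "0 \<le> d i"
proof -
  obtain v where "v \<in> carrier_vec n" "Re ((X *\<^sub>v v) \<bullet>c v) = d i"
    using congr_diag_coeff[OF unitary_diagD(1)[OF X U] mat_adjoint_carrier[OF unitary_diagD(1)[OF X U]]
        unitary_diagD(2)[OF X U] i] unitary_diagD(3)[OF X U] by blast
  then show ?thesis using psd X unfolding pos_semidef_def by fastforce
qed

lemma eigenvalues_mono:
  assumes A: "A \<in> carrier_mat n n" and B: "B \<in> carrier_mat n n" and psd: "pos_semidef (A - B)"
    and U: "unitary_diag A U a" "\<And>i j. i \<le> j \<Longrightarrow> j < n \<Longrightarrow> a j \<le> a i"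
    and V: "unitary_diag B V b" "\<And>i j. i \<le> j \<Longrightarrow> j < n \<Longrightarrow> b j \<le> b i"
    and i: "i < n"
  shows "b i \<le> a i"
proof (rule weyl_monotonicity[OF unitary_diagD(1,2)[OF B V(1)] unitary_diagD(1,2)[OF A U(1)] V(2) U(2) _ i])
  fix v :: "complex vec" assume v: "v \<in> carrier_vec n"
  have "0 \<le> Re (((A - B) *\<^sub>v v) \<bullet>c v)"
    using psd v B unfolding pos_semidef_def by auto
  also have "\<dots> = Re ((A *\<^sub>v v) \<bullet>c v) - Re ((B *\<^sub>v v) \<bullet>c v)"
    using A B v by (simp add: minus_mult_distrib_mat_vec minus_scalar_prod_distrib[of _ n])
  finally show "(\<Sum>j<n. b j * (cmod ((mat_adjoint V *\<^sub>v v) $ j))\<^sup>2) \<le>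
      (\<Sum>j<n. a j * (cmod ((mat_adjoint U *\<^sub>v v) $ j))\<^sup>2)"
    by (simp only: hermitian_quadratic_form[OF A U(1) v] hermitian_quadratic_form[OF B V(1) v] diff_ge_0_iff_ge)
qed

section \<open>The determinant inequality\<close>

lemma unitary_diag_shift:
  assumes X: "X \<in> carrier_mat n n" and U: "unitary_diag X U d"
  shows "unitary_diag (X + congr_diag n (1\<^sub>m n) (\<lambda>_. s)) U (\<lambda>i. d i + s)"
proof -
  have Uc: "U \<in> carrier_mat n n" "mat_adjoint U * U = 1\<^sub>m n" and XU: "X = congr_diag n U d"
    using unitary_diagD[OF X U] by blast+
  note U' = mat_adjoint_carrier[OF Uc(1)]
  have D: "mat_diag n (\<lambda>_. complex_of_real s) = of_real s \<cdot>\<^sub>m 1\<^sub>m n"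
    by (intro eq_matI) (auto simp: mat_diag_def)
  have "congr_diag n U (\<lambda>_. s) = of_real s \<cdot>\<^sub>m (U * mat_adjoint U)"
    using Uc U' by (simp add: congr_diag_def D mult_smult_distrib[of _ n n _ n] mult_smult_assoc_mat[of _ n n _ n])
  also have "\<dots> = congr_diag n (1\<^sub>m n) (\<lambda>_. s)"
    by (simp add: congr_diag_def D unitary_right_inverse[OF Uc])
  finally have "congr_diag n (1\<^sub>m n) (\<lambda>_. s) = congr_diag n U (\<lambda>_. s)" by simp
  then have "X + congr_diag n (1\<^sub>m n) (\<lambda>_. s) = congr_diag n U (\<lambda>i. d i + s)"
    by (simp add: XU congr_diag_add[OF Uc(1)])
  moreover have "X + congr_diag n (1\<^sub>m n) (\<lambda>_. s) \<in> carrier_mat n n"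
    using X congr_diag_carrier[of "1\<^sub>m n" n] by auto
  ultimately show ?thesis using Uc by (simp add: unitary_diag_iff)
qed

lemma det_unitary_diag:
  assumes X: "X \<in> carrier_mat n n" and U: "unitary_diag X U d"
  shows "det X = of_real (\<Prod>i<n. d i)"
proof -
  have Uc: "U \<in> carrier_mat n n" "mat_adjoint U * U = 1\<^sub>m n" and XU: "X = congr_diag n U d"
    using unitary_diagD[OF X U] by blast+
  have "det U * det (mat_adjoint U) = 1"
    using det_mult[OF Uc(1) mat_adjoint_carrier[OF Uc(1)]] unitary_right_inverse[OF Uc] by simp
  then show ?thesis by (simp add: XU det_congr_diag[OF Uc(1)])
qed

text \<open>
  Take \<open>S = U P W\<close> where \<open>P\<close> is the diagonal matrix of the \<open>sqrt (a i)\<close> and \<open>W\<close> diagonalizes the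
  Hermitian matrix \<open>C = (U P)\<^sup>-\<^sup>1 B ((U P)\<^sup>-\<^sup>1)\<^sup>*\<close>.
\<close>

lemma simultaneous_congruence:
  assumes A: "A \<in> carrier_mat n n" and U: "unitary_diag A U a" and a: "\<And>i. i < n \<Longrightarrow> 0 < a i"
    and B: "B \<in> carrier_mat n n" "mat_adjoint B = B"
  obtains S R c where "S \<in> carrier_mat n n" "R \<in> carrier_mat n n" "R * S = 1\<^sub>m n"
    "A = congr_diag n S (\<lambda>_. 1)" "B = congr_diag n S c"
proof -
  have Uc: "U \<in> carrier_mat n n" and UU: "mat_adjoint U * U = 1\<^sub>m n" and AU: "A = congr_diag n U a"
    using unitary_diagD[OF A U] by blast+
  note U' = mat_adjoint_carrier[OF Uc]
  note UU2 = unitary_right_inverse[OF Uc UU]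
  note assoc = assoc_mult_mat[of _ n n _ n _ n]
  note carr = mult_carrier_mat[of _ n n _ n]
  note adj = mat_adjoint_mult[of _ n n _ n]
  define P where "P = mat_diag n (\<lambda>i. complex_of_real (sqrt (a i)))"
  define Q where "Q = mat_diag n (\<lambda>i. complex_of_real (1 / sqrt (a i)))"
  have PQc: "P \<in> carrier_mat n n" "Q \<in> carrier_mat n n" by (auto simp: P_def Q_def)
  have "complex_of_real (sqrt (a i)) * of_real (1 / sqrt (a i)) = 1" if "i < n" for i
    using a[OF that] by (simp flip: of_real_mult)
  then have "mat_diag n (\<lambda>i. complex_of_real (sqrt (a i)) * of_real (1 / sqrt (a i))) = mat_diag n (\<lambda>i. 1)"
    by (rule mat_diag_cong)
  then have PQ: "P * Q = 1\<^sub>m n" "Q * P = 1\<^sub>m n"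
    unfolding P_def Q_def mat_diag_diag mat_diag_one by (simp_all only: mult.commute)
  have PP: "P * P = mat_diag n (\<lambda>i. complex_of_real (a i))"
    unfolding P_def mat_diag_diag using a
    by (intro mat_diag_cong) (simp add: less_imp_le flip: of_real_mult)
  have adjPQ: "mat_adjoint P = P" "mat_adjoint Q = Q"
    unfolding P_def Q_def by (rule mat_adjoint_mat_diag_real)+
  define G where "G = Q * mat_adjoint U"
  have G: "G \<in> carrier_mat n n" using PQc U' by (simp add: G_def carr)
  have G': "mat_adjoint G = U * Q" using PQc U' by (simp add: G_def adj adjPQ)
  define C where "C = G * B * mat_adjoint G"
  have C: "C \<in> carrier_mat n n" using G B mat_adjoint_carrier[OF G] by (simp add: C_def carr)
  have hC: "mat_adjoint C = C"
    using G B mat_adjoint_carrier[OF G] by (simp add: C_def adj carr assoc)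
  obtain W c where W: "unitary_diag C W c" by (rule hermitian_unitary_diag[OF C hC])
  then have Wc: "W \<in> carrier_mat n n" and WW: "mat_adjoint W * W = 1\<^sub>m n" and CW: "C = congr_diag n W c"
    using unitary_diagD[OF C] by blast+
  note W' = mat_adjoint_carrier[OF Wc]
  note WW2 = unitary_right_inverse[OF Wc WW]
  define S where "S = U * P * W"
  define R where "R = mat_adjoint W * G"
  have S: "S \<in> carrier_mat n n" and R: "R \<in> carrier_mat n n"
    using Uc PQc Wc W' G by (auto simp: S_def R_def)
  have S': "mat_adjoint S = mat_adjoint W * (P * mat_adjoint U)"
    using Uc U' PQc Wc W' by (simp add: S_def adj carr adjPQ assoc)
  have "R * S = mat_adjoint W * (Q * (mat_adjoint U * U) * P) * W"
    using Uc U' PQc Wc W' by (simp add: R_def S_def G_def carr assoc)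
  then have RS: "R * S = 1\<^sub>m n" using PQc Wc W' by (simp add: UU PQ WW)
  have "congr_diag n S (\<lambda>_. 1) = U * P * (W * mat_adjoint W) * (P * mat_adjoint U)"
    unfolding congr_diag_def S' unfolding S_def using Uc U' PQc Wc W' by (simp add: carr assoc)
  also have "\<dots> = U * (P * P) * mat_adjoint U"
    using Uc U' PQc by (simp add: WW2 carr assoc)
  finally have "A = congr_diag n S (\<lambda>_. 1)" by (simp add: AU congr_diag_def PP)
  moreover have "B = congr_diag n S c"
  proof -
    have "congr_diag n S c = U * P * congr_diag n W c * (P * mat_adjoint U)"
      unfolding congr_diag_def S' unfolding S_def using Uc U' PQc Wc W' by (simp add: carr assoc)
    also have "\<dots> = U * P * (Q * mat_adjoint U * B * (U * Q)) * (P * mat_adjoint U)"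
      unfolding CW[symmetric] C_def G' unfolding G_def ..
    also have "\<dots> = U * (P * Q) * mat_adjoint U * B * (U * (Q * P) * mat_adjoint U)"
      using Uc U' PQc B by (simp add: carr assoc)
    also have "\<dots> = B" using Uc U' PQc B by (simp add: PQ UU2 carr assoc)
    finally show ?thesis by simp
  qed
  ultimately show thesis by (rule that[OF S R RS])
qed

text \<open>
  The shift by \<open>s\<close> makes \<open>A\<close> positive definite and \<open>A - B\<close> strictly positive, so that all quotients
  below are defined and less than \<open>1\<close>. Each determinant is \<open>det S * det S\<^sup>* = \<alpha>\<close> times a diagonal product.
\<close>

lemma det_sum_diff_le:
  assumes A: "A \<in> carrier_mat n n" and B: "B \<in> carrier_mat n n"
    and herm: "mat_adjoint B = B"
    and psd: "pos_semidef B" "pos_semidef (A - B)"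
    and U: "unitary_diag A U a" "\<And>i j. i \<le> j \<Longrightarrow> j < n \<Longrightarrow> a j \<le> a i"
    and V: "unitary_diag B V b" "\<And>i j. i \<le> j \<Longrightarrow> j < n \<Longrightarrow> b j \<le> b i"
    and W1: "unitary_diag (A + B) W1 \<mu>" and W2: "unitary_diag (A - B) W2 \<nu>"
    and s: "0 < s"
  shows "(\<Prod>i<n. (s + \<mu> i) * (s + \<nu> i)) \<le> (\<Prod>i<n. (s + a i)\<^sup>2 - (b i)\<^sup>2)"
proof -
  have AB: "A + B \<in> carrier_mat n n" "A - B \<in> carrier_mat n n" using A B by auto
  have Uc: "U \<in> carrier_mat n n" "mat_adjoint U * U = 1\<^sub>m n" and AU: "A = congr_diag n U a"
    using unitary_diagD[OF A U(1)] by blast+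
  have Vc: "V \<in> carrier_mat n n" "mat_adjoint V * V = 1\<^sub>m n" and BV: "B = congr_diag n V b"
    using unitary_diagD[OF B V(1)] by blast+
  have diff_nonneg: "0 \<le> Re (((A - B) *\<^sub>v v) \<bullet>c v)" if "v \<in> carrier_vec n" for v
    using psd(2) that AB unfolding pos_semidef_def by auto
  have qdiff: "Re (((X - Y) *\<^sub>v v) \<bullet>c v) = Re ((X *\<^sub>v v) \<bullet>c v) - Re ((Y *\<^sub>v v) \<bullet>c v)"
    if "X \<in> carrier_mat n n" "Y \<in> carrier_mat n n" "v \<in> carrier_vec n" for X Y v
    using that by (simp add: minus_mult_distrib_mat_vec minus_scalar_prod_distrib[of _ n])
  have b0: "0 \<le> b i" if "i < n" for i
    using pos_semidef_eigenvalues_nonneg[OF B psd(1) V(1) that] .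
  have ba: "b i \<le> a i" if "i < n" for i
    by (rule eigenvalues_mono[OF A B psd(2) U V that])
  define I where "I = congr_diag n (1\<^sub>m n) (\<lambda>_. s)"
  have I: "I \<in> carrier_mat n n" using congr_diag_carrier[of "1\<^sub>m n" n] by (simp add: I_def)
  define A' where "A' = A + I"
  have A': "A' \<in> carrier_mat n n" using A I by (simp add: A'_def)
  have U': "unitary_diag A' U (\<lambda>i. a i + s)" unfolding A'_def I_def by (rule unitary_diag_shift[OF A U(1)])
  have a': "0 < a i + s" if "i < n" for i using b0[OF that] ba[OF that] s by simp
  \<comment> \<open>\<open>R\<close> is the inverse of \<open>S\<close>; it provides the test vectors that bound the entries of \<open>c\<close>.\<close>
  obtain S R c where S: "S \<in> carrier_mat n n" and R: "R \<in> carrier_mat n n" "R * S = 1\<^sub>m n"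
    and AS: "A' = congr_diag n S (\<lambda>_. 1)" and BS: "B = congr_diag n S c"
    using simultaneous_congruence[OF A' U' a' B herm] by blast
  have c: "0 \<le> c i \<and> c i < 1" if i: "i < n" for i
  proof -
    obtain v where v: "v \<in> carrier_vec n" and co: "\<And>d. Re ((congr_diag n S d *\<^sub>v v) \<bullet>c v) = d i"
      using congr_diag_coeff[OF S R i] by blast
    have q: "Re ((A' *\<^sub>v v) \<bullet>c v) = 1" "Re ((B *\<^sub>v v) \<bullet>c v) = c i"
      using co[of "\<lambda>_. 1"] co[of c] by (simp_all add: AS BS)
    have "0 \<le> Re ((B *\<^sub>v v) \<bullet>c v)" using psd(1) v B unfolding pos_semidef_def by auto
    moreover have "Re ((B *\<^sub>v v) \<bullet>c v) < Re ((A' *\<^sub>v v) \<bullet>c v)"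
    proof -
      have "0 \<le> Re ((A *\<^sub>v v) \<bullet>c v) - Re ((B *\<^sub>v v) \<bullet>c v)"
        using diff_nonneg[OF v] qdiff[OF A B v] by simp
      moreover have "Re ((A' *\<^sub>v v) \<bullet>c v) = Re ((A *\<^sub>v v) \<bullet>c v) + Re ((I *\<^sub>v v) \<bullet>c v)"
        using A I v by (simp add: A'_def add_mult_distrib_mat_vec[of _ n n] add_scalar_prod_distrib[of _ n])
      moreover have "0 < Re ((I *\<^sub>v v) \<bullet>c v)"
      proof -
        define L where "L = (\<Sum>j<n. (cmod (v $ j))\<^sup>2)"
        have IL: "Re ((I *\<^sub>v v) \<bullet>c v) = s * L"
          using congr_diag_quadratic_form[of "1\<^sub>m n" n v "\<lambda>_. s"] v
          by (simp add: I_def L_def sum_distrib_left)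
        have "0 \<le> L" by (simp add: L_def sum_nonneg)
        moreover have "L \<noteq> 0"
        proof
          assume "L = 0"
          then have "v = 0\<^sub>v n" using v by (intro eq_vecI) (auto simp: L_def sum_nonneg_eq_0_iff)
          then have "Re ((A' *\<^sub>v v) \<bullet>c v) = 0" using A' by simp
          with q(1) show False by simp
        qed
        ultimately show ?thesis using IL s by simp
      qed
      ultimately show ?thesis by simp
    qed
    ultimately show ?thesis using q by simp
  qed
  define \<delta> where "\<delta> = det S * det (mat_adjoint S)"
  define \<alpha> where "\<alpha> = (\<Prod>i<n. a i + s)"
  have \<alpha>: "0 < \<alpha>" unfolding \<alpha>_def using a' by (intro prod_pos) auto
  have \<delta>: "\<delta> = of_real \<alpha>"
    using det_unitary_diag[OF A' U'] det_congr_diag[OF S, of "\<lambda>_. 1"] by (simp add: AS[symmetric] \<delta>_def \<alpha>_def)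
  have detS: "(\<Prod>i<n. e i) = \<alpha> * (\<Prod>i<n. d i)"
    if "unitary_diag (congr_diag n S d) W e" for W e d
  proof -
    have "complex_of_real (\<Prod>i<n. e i) = of_real (\<alpha> * (\<Prod>i<n. d i))"
      using det_unitary_diag[OF congr_diag_carrier[OF S] that] det_congr_diag[OF S, of d]
      by (simp add: \<delta>_def[symmetric] \<delta>)
    then show ?thesis by (simp only: of_real_eq_iff)
  qed
  have comm: "A + B + I = A' + B" "A - B + I = A' - B"
    using A B I by (auto simp: A'_def intro!: eq_matI)
  have SP: "A' + B = congr_diag n S (\<lambda>i. 1 + c i)" and SM: "A' - B = congr_diag n S (\<lambda>i. 1 - c i)"
    unfolding AS BS by (rule congr_diag_add[OF S] congr_diag_minus[OF S])+
  have plus: "(\<Prod>i<n. \<mu> i + s) = \<alpha> * (\<Prod>i<n. 1 + c i)"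
    using unitary_diag_shift[OF AB(1) W1, of s, folded I_def, unfolded comm SP] by (rule detS)
  have minus: "(\<Prod>i<n. \<nu> i + s) = \<alpha> * (\<Prod>i<n. 1 - c i)"
    using unitary_diag_shift[OF AB(2) W2, of s, folded I_def, unfolded comm SM] by (rule detS)
  have "(\<Prod>i<n. max (b i / (a i + s)) \<theta>) \<le> (\<Prod>i<n. max (c i) \<theta>)" if \<theta>: "0 < \<theta>" for \<theta>
  proof -
    \<comment> \<open>Since \<open>m\<close> dominates both \<open>c\<close> and the constant \<open>\<theta>\<close>, \<open>M\<close> dominates both \<open>B\<close> and \<open>\<theta> * A'\<close>.\<close>
    define m where "m i = max (c i) \<theta>" for i
    define M where "M = congr_diag n S m"
    have M: "M \<in> carrier_mat n n" unfolding M_def by (rule congr_diag_carrier[OF S])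
    obtain T d where T: "unitary_diag M T d" "\<And>i j. i \<le> j \<Longrightarrow> j < n \<Longrightarrow> d j \<le> d i"
      using hermitian_unitary_diag[OF M] congr_diag_hermitian[OF S] unfolding M_def by metis
    have Tc: "T \<in> carrier_mat n n" "mat_adjoint T * T = 1\<^sub>m n"
      using unitary_diagD[OF M T(1)] by blast+
    have form: "(\<Sum>j<n. d j * (cmod ((mat_adjoint T *\<^sub>v v) $ j))\<^sup>2) =
        (\<Sum>j<n. m j * (cmod ((mat_adjoint S *\<^sub>v v) $ j))\<^sup>2)" if v: "v \<in> carrier_vec n" for v
      using hermitian_quadratic_form[OF M T(1) v] congr_diag_quadratic_form[OF S v, of m]
      by (metis M_def Re_complex_of_real)
    have "b i \<le> d i" if "i < n" for i
    proof (rule weyl_monotonicity[OF Vc Tc V(2) T(2) _ that])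
      fix v :: "complex vec" assume v: "v \<in> carrier_vec n"
      have "(\<Sum>j<n. b j * (cmod ((mat_adjoint V *\<^sub>v v) $ j))\<^sup>2) = (\<Sum>j<n. c j * (cmod ((mat_adjoint S *\<^sub>v v) $ j))\<^sup>2)"
        using hermitian_quadratic_form[OF B V(1) v] congr_diag_quadratic_form[OF S v, of c]
        by (metis BS Re_complex_of_real)
      also have "\<dots> \<le> (\<Sum>j<n. m j * (cmod ((mat_adjoint S *\<^sub>v v) $ j))\<^sup>2)"
        by (intro sum_mono mult_right_mono) (auto simp: m_def)
      finally show "(\<Sum>j<n. b j * (cmod ((mat_adjoint V *\<^sub>v v) $ j))\<^sup>2) \<le>
          (\<Sum>j<n. d j * (cmod ((mat_adjoint T *\<^sub>v v) $ j))\<^sup>2)" by (simp only: form[OF v])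
    qed auto
    moreover have "\<theta> * (a i + s) \<le> d i" if "i < n" for i
    proof (rule weyl_monotonicity[OF Uc Tc _ T(2) _ that])
      fix v :: "complex vec" assume v: "v \<in> carrier_vec n"
      have "(\<Sum>j<n. \<theta> * (a j + s) * (cmod ((mat_adjoint U *\<^sub>v v) $ j))\<^sup>2) =
          \<theta> * (\<Sum>j<n. (a j + s) * (cmod ((mat_adjoint U *\<^sub>v v) $ j))\<^sup>2)"
        by (simp add: sum_distrib_left mult.assoc)
      also have "(\<Sum>j<n. (a j + s) * (cmod ((mat_adjoint U *\<^sub>v v) $ j))\<^sup>2) = (\<Sum>j<n. 1 * (cmod ((mat_adjoint S *\<^sub>v v) $ j))\<^sup>2)"
        using hermitian_quadratic_form[OF A' U' v] congr_diag_quadratic_form[OF S v, of "\<lambda>_. 1"]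
        by (metis AS Re_complex_of_real)
      also have "\<theta> * \<dots> = (\<Sum>j<n. \<theta> * (cmod ((mat_adjoint S *\<^sub>v v) $ j))\<^sup>2)"
        by (simp add: sum_distrib_left)
      also have "\<dots> \<le> (\<Sum>j<n. m j * (cmod ((mat_adjoint S *\<^sub>v v) $ j))\<^sup>2)"
        by (intro sum_mono mult_right_mono) (auto simp: m_def)
      finally show "(\<Sum>j<n. \<theta> * (a j + s) * (cmod ((mat_adjoint U *\<^sub>v v) $ j))\<^sup>2) \<le>
          (\<Sum>j<n. d j * (cmod ((mat_adjoint T *\<^sub>v v) $ j))\<^sup>2)" by (simp only: form[OF v])
    next
      show "\<theta> * (a j + s) \<le> \<theta> * (a i + s)" if "i \<le> j" "j < n" for i j
        using U(2)[OF that] \<theta> by simp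
    qed auto
    ultimately have "max (b i / (a i + s)) \<theta> * (a i + s) \<le> d i" if "i < n" for i
      using that a'[OF that] a'[OF that, THEN less_imp_neq, THEN not_sym] by (simp add: max_def)
    then have "(\<Prod>i<n. max (b i / (a i + s)) \<theta> * (a i + s)) \<le> (\<Prod>i<n. d i)"
      using a' \<theta> by (intro prod_mono) (auto intro!: mult_nonneg_nonneg simp: le_max_iff_disj less_imp_le)
    also have "\<dots> = \<alpha> * (\<Prod>i<n. m i)" using T(1) by (intro detS[of _ T]) (simp add: M_def)
    finally show ?thesis using \<alpha> by (simp add: prod.distrib \<alpha>_def[symmetric] m_def mult.commute)
  qed
  moreover have "0 \<le> b i / (a i + s) \<and> b i / (a i + s) < 1" if "i < n" for i
    using b0[OF that] ba[OF that] a'[OF that] s by simp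
  ultimately have le: "(\<Prod>i<n. 1 - (c i)\<^sup>2) \<le> (\<Prod>i<n. 1 - (b i / (a i + s))\<^sup>2)"
    using c by (intro prod_one_minus_square_le) auto
  have "(\<Prod>i<n. (s + \<mu> i) * (s + \<nu> i)) = (\<Prod>i<n. \<mu> i + s) * (\<Prod>i<n. \<nu> i + s)"
    by (simp add: prod.distrib add.commute)
  also have "\<dots> = \<alpha>\<^sup>2 * (\<Prod>i<n. (1 + c i) * (1 - c i))"
    unfolding plus minus by (simp add: prod.distrib power2_eq_square)
  also have "\<dots> = \<alpha>\<^sup>2 * (\<Prod>i<n. 1 - (c i)\<^sup>2)"
    by (simp add: algebra_simps power2_eq_square)
  also have "\<dots> \<le> \<alpha>\<^sup>2 * (\<Prod>i<n. 1 - (b i / (a i + s))\<^sup>2)"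
    using le by (intro mult_left_mono) auto
  also have "\<dots> = (\<Prod>i<n. (a i + s)\<^sup>2 * (1 - (b i / (a i + s))\<^sup>2))"
    by (simp add: \<alpha>_def prod.distrib prod_power_distrib)
  also have "\<dots> = (\<Prod>i<n. (s + a i)\<^sup>2 - (b i)\<^sup>2)"
  proof (intro prod.cong refl)
    fix i assume "i \<in> {..<n}"
    then have "a i + s \<noteq> 0" using a'[of i] by auto
    then show "(a i + s)\<^sup>2 * (1 - (b i / (a i + s))\<^sup>2) = (s + a i)\<^sup>2 - (b i)\<^sup>2"
      by (simp add: right_diff_distrib power_divide add.commute)
  qed
  finally show ?thesis .
qed

section \<open>Trace norms and singular values\<close>

lemma mat_trace_comm:
  assumes "A \<in> carrier_mat n m" "B \<in> carrier_mat m n"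
  shows "mat_trace (A * B) = mat_trace (B * A)"
proof -
  have "mat_trace (A * B) = (\<Sum>i<n. \<Sum>j<m. A $$ (i, j) * B $$ (j, i))"
    using assms by (simp add: mat_trace_def scalar_prod_def lessThan_atLeast0)
  also have "\<dots> = (\<Sum>j<m. \<Sum>i<n. A $$ (i, j) * B $$ (j, i))" by (rule sum.swap)
  also have "\<dots> = mat_trace (B * A)"
    using assms by (simp add: mat_trace_def scalar_prod_def lessThan_atLeast0 mult.commute)
  finally show ?thesis .
qed

lemma mat_trace_add:
  "A \<in> carrier_mat n n \<Longrightarrow> B \<in> carrier_mat n n \<Longrightarrow> mat_trace (A + B) = mat_trace A + mat_trace B"
  by (simp add: mat_trace_def sum.distrib)

lemma mat_trace_congr_diag_unitary:
  assumes U: "U \<in> carrier_mat n n" "mat_adjoint U * U = 1\<^sub>m n"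
  shows "mat_trace (congr_diag n U d) = of_real (\<Sum>i<n. d i)"
proof -
  let ?D = "mat_diag n (\<lambda>i. complex_of_real (d i))"
  note U' = mat_adjoint_carrier[OF U(1)]
  have "mat_trace (congr_diag n U d) = mat_trace (mat_adjoint U * (U * ?D))"
    unfolding congr_diag_def using U U' by (intro mat_trace_comm[of _ n n]) auto
  also have "mat_adjoint U * (U * ?D) = ?D"
    using U U' by (simp add: assoc_mult_mat[symmetric, of _ n n _ n _ n] left_mult_one_mat[OF mat_diag_dim])
  also have "mat_trace ?D = of_real (\<Sum>i<n. d i)" by (simp add: mat_trace_def mat_diag_def)
  finally show ?thesis .
qed

lemma mat_abs_pos_semidef:
  assumes X: "X \<in> carrier_mat n n" and U: "unitary_diag X U d" and d: "\<And>i. i < n \<Longrightarrow> 0 \<le> d i"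
  shows "mat_abs X = X"
proof -
  have Uc: "U \<in> carrier_mat n n" "mat_adjoint U * U = 1\<^sub>m n" and XU: "X = congr_diag n U d"
    using unitary_diagD[OF X U] by blast+
  note U' = mat_adjoint_carrier[OF Uc(1)]
  let ?D = "mat_diag n (\<lambda>i. complex_of_real (d i))"
  have "mat_adjoint X * X = U * ?D * (mat_adjoint U * U) * (?D * mat_adjoint U)"
    using Uc(1) U' congr_diag_hermitian[OF Uc(1), of d] unfolding XU
    by (simp add: congr_diag_def assoc_mult_mat[of _ n n _ n _ n] mult_carrier_mat[of _ n n _ n])
  also have "\<dots> = U * (?D * ?D) * mat_adjoint U"
    using Uc U' by (simp add: assoc_mult_mat[of _ n n _ n _ n] mult_carrier_mat[of _ n n _ n]
        left_mult_one_mat[OF mult_carrier_mat[OF mat_diag_dim U']] del: mat_diag_diag)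
  finally have XX: "mat_adjoint X * X = congr_diag n U (\<lambda>i. d i * d i)"
    by (simp add: congr_diag_def)
  have XXc: "mat_adjoint X * X \<in> carrier_mat n n" using X mat_adjoint_carrier[OF X] by auto
  have "unitary_diag (mat_adjoint X * X) U (\<lambda>i. d i * d i)"
    unfolding unitary_diag_iff[OF XXc] using Uc XX by blast
  from mat_fun_eq[OF this, of sqrt]
  have "mat_abs X = congr_diag n U (\<lambda>i. sqrt (d i * d i))"
    using X by (simp add: mat_abs_def congr_diag_def)
  also have "\<dots> = X" unfolding XU congr_diag_def
    using d by (auto intro!: arg_cong2[of _ _ _ _ "(*)"] mat_diag_cong)
  finally show ?thesis .
qed

text \<open>
  The outer power \<open>1 / p\<close> in the norm cancels because the sum is nonnegative.
\<close>

lemma trace_norm_powr: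
  assumes X: "X \<in> carrier_mat n n" and U: "unitary_diag X U d" and d: "\<And>i. i < n \<Longrightarrow> 0 \<le> d i"
    and p: "p \<noteq> 0"
  shows "trace_norm p X powr p = (\<Sum>i<n. d i powr p)"
proof -
  have Uc: "U \<in> carrier_mat n n" "mat_adjoint U * U = 1\<^sub>m n"
    using unitary_diagD[OF X U] by blast+
  have "mat_fun (\<lambda>t. t powr p) X = congr_diag n U (\<lambda>i. d i powr p)"
    using mat_fun_eq[OF U] X by (simp add: congr_diag_def)
  then have "Re (mat_trace (mat_fun (\<lambda>t. t powr p) (mat_abs X))) = (\<Sum>i<n. d i powr p)"
    by (simp add: mat_abs_pos_semidef[OF X U d] mat_trace_congr_diag_unitary[OF Uc])
  moreover have "0 \<le> (\<Sum>i<n. d i powr p)" by (intro sum_nonneg) simp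
  ultimately show ?thesis using p by (simp add: trace_norm_def powr_powr)
qed

lemma trace_norm_powr_mat_diag:
  assumes d: "\<And>i. i < n \<Longrightarrow> 0 \<le> d i" and p: "p \<noteq> 0"
  shows "trace_norm p (mat_diag n (\<lambda>i. of_real (d i))) powr p = (\<Sum>i<n. d i powr p)"
proof (rule trace_norm_powr[OF _ _ d p])
  show "unitary_diag (mat_diag n (\<lambda>i. of_real (d i))) (1\<^sub>m n) d"
    unfolding unitary_diag_iff[OF mat_diag_dim]
    by (simp add: congr_diag_def left_mult_one_mat[OF mat_diag_dim] right_mult_one_mat[OF mat_diag_dim])
qed simp

text \<open>
  A positive semidefinite matrix is its own absolute value, so its singular values are its eigenvalues;
  sorting them changes nothing as \<open>d\<close> is decreasing already.
\<close>

lemma singular_values_nth: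
  assumes X: "X \<in> carrier_mat n n" and U: "unitary_diag X U d" and d: "\<And>i. i < n \<Longrightarrow> 0 \<le> d i"
    and mono: "\<And>i j. i \<le> j \<Longrightarrow> j < n \<Longrightarrow> d j \<le> d i" and i: "i < n"
  shows "singular_values X ! i = d i"
proof -
  have "proots (char_poly X) = mset (map (\<lambda>i. complex_of_real (d i)) [0..<n])"
  proof -
    have "proots (\<Prod>e\<leftarrow>es. [:- e, 1:]) = mset es" for es :: "complex list"
    proof (induction es)
      case (Cons e es)
      have "(\<Prod>e\<leftarrow>es. [:- e, 1:]) \<noteq> 0" by (auto simp: prod_list_zero_iff)
      then have "proots ([:- e, 1:] * (\<Prod>e\<leftarrow>es. [:- e, 1:])) = {#e#} + mset es"
        using Cons.IH by (subst proots_mult) auto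
      then show ?case by simp
    qed simp
    then show ?thesis unfolding char_poly_unitary_diag[OF X U] .
  qed
  then have "image_mset Re (proots (char_poly (mat_abs X))) = mset (map d [0..<n])"
    by (simp add: mat_abs_pos_semidef[OF X U d] multiset.map_comp comp_def)
  then have "singular_values X = rev (sort (map d [0..<n]))"
    by (simp only: singular_values_def sorted_list_of_multiset_mset)
  also have "sort (map d [0..<n]) = rev (map d [0..<n])"
  proof (rule properties_for_sort)
    show "sorted (rev (map d [0..<n]))"
      using mono by (auto simp: sorted_rev_iff_nth_mono)
  qed simp
  finally show ?thesis using i by simp
qed

theorem theorem2p3:
  fixes A B :: "complex mat" and n :: nat and p :: real
  assumes "1 \<le> n" and "1 \<le> p" and "p \<le> 2"
    and "A \<in> carrier_mat n n" and "B \<in> carrier_mat n n"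
    and "self_adjoint A" and "self_adjoint B"
    and "A \<succeq> B" and "B \<succeq> 0\<^sub>m n n"
  shows "trace_norm p (A + B) powr p + trace_norm p (A - B) powr p \<ge>
         trace_norm p (\<Sigma>\<^sub>\<up> A + \<Sigma>\<^sub>\<up> B) powr p + trace_norm p (\<Sigma>\<^sub>\<up> A - \<Sigma>\<^sub>\<up> B) powr p"
proof -
  note p = \<open>1 \<le> p\<close> \<open>p \<le> 2\<close> and A = \<open>A \<in> carrier_mat n n\<close> and B = \<open>B \<in> carrier_mat n n\<close>
  have hA: "mat_adjoint A = A" and hB: "mat_adjoint B = B"
    using assms(6,7) by (auto simp: self_adjoint_def)
  have "B - 0\<^sub>m n n = B" using B by (intro eq_matI) auto
  then have psdB: "pos_semidef B" and psdD: "pos_semidef (A - B)"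
    using assms(8,9) by (auto simp: loewner_ge_def)
  have P: "A + B \<in> carrier_mat n n" and D: "A - B \<in> carrier_mat n n" using A B by auto
  have hP: "mat_adjoint (A + B) = A + B"
  proof (rule eq_matI)
    fix i j assume "i < dim_row (A + B)" "j < dim_col (A + B)"
    then show "mat_adjoint (A + B) $$ (i, j) = (A + B) $$ (i, j)"
      using A B arg_cong[OF hA, of "\<lambda>M. M $$ (i, j)"] arg_cong[OF hB, of "\<lambda>M. M $$ (i, j)"]
      by simp
  qed (use A B in auto)
  have hD: "mat_adjoint (A - B) = A - B" using psdD by (simp add: pos_semidef_def self_adjoint_def)
  obtain U a where U: "unitary_diag A U a" "\<And>i j. i \<le> j \<Longrightarrow> j < n \<Longrightarrow> a j \<le> a i"
    using hermitian_unitary_diag[OF A hA] by metis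
  obtain V b where V: "unitary_diag B V b" "\<And>i j. i \<le> j \<Longrightarrow> j < n \<Longrightarrow> b j \<le> b i"
    using hermitian_unitary_diag[OF B hB] by metis
  obtain W1 \<mu> where W1: "unitary_diag (A + B) W1 \<mu>" using hermitian_unitary_diag[OF P hP] by metis
  obtain W2 \<nu> where W2: "unitary_diag (A - B) W2 \<nu>" using hermitian_unitary_diag[OF D hD] by metis
  have b0: "0 \<le> b i" if "i < n" for i using pos_semidef_eigenvalues_nonneg[OF B psdB V(1) that] .
  have \<nu>0: "0 \<le> \<nu> i" if "i < n" for i using pos_semidef_eigenvalues_nonneg[OF D psdD W2 that] .
  have ba: "b i \<le> a i" if "i < n" for i
    by (rule eigenvalues_mono[OF A B psdD U V that])
  have \<mu>0: "0 \<le> \<mu> i" if "i < n" for i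
  proof (rule pos_semidef_eigenvalues_nonneg[OF P _ W1 that])
    have "0 \<le> Re (((A + B) *\<^sub>v v) \<bullet>c v)" if v: "v \<in> carrier_vec n" for v
    proof -
      have "0 \<le> Re ((A *\<^sub>v v) \<bullet>c v)"
        unfolding hermitian_quadratic_form[OF A U(1) v]
        by (intro sum_nonneg mult_nonneg_nonneg) (use b0 ba in \<open>force intro: order_trans\<close>)+
      moreover have "0 \<le> Re ((B *\<^sub>v v) \<bullet>c v)"
        unfolding hermitian_quadratic_form[OF B V(1) v]
        by (intro sum_nonneg mult_nonneg_nonneg) (use b0 in auto)
      ultimately show ?thesis
        using A B v by (simp add: add_mult_distrib_mat_vec[of _ n n] add_scalar_prod_distrib[of _ n])
    qed
    then show "pos_semidef (A + B)"
      using A B hP by (simp add: pos_semidef_def self_adjoint_def)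
  qed
  have a0: "0 \<le> a i" if "i < n" for i using b0[OF that] ba[OF that] by simp
  have p0: "p \<noteq> 0" using p by simp
  have S: "\<Sigma>\<^sub>\<up> A = mat_diag n (\<lambda>i. of_real (a i))" "\<Sigma>\<^sub>\<up> B = mat_diag n (\<lambda>i. of_real (b i))"
    using A B singular_values_nth[OF A U(1) a0 U(2)] singular_values_nth[OF B V(1) b0 V(2)]
    by (auto simp: Sigma_up_def intro!: mat_diag_cong)
  have Splus: "\<Sigma>\<^sub>\<up> A + \<Sigma>\<^sub>\<up> B = mat_diag n (\<lambda>i. of_real (a i + b i))"
    and Sminus: "\<Sigma>\<^sub>\<up> A - \<Sigma>\<^sub>\<up> B = mat_diag n (\<lambda>i. of_real (a i - b i))"
    unfolding S by (auto simp: mat_diag_def intro!: eq_matI)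
  \<comment> \<open>The sum type indexes the two eigenvalue families jointly, as needed for \<open>sum_powr_le\<close>.\<close>
  define x where "x = case_sum \<mu> \<nu>"
  define y where "y = case_sum (\<lambda>i. a i + b i) (\<lambda>i. a i - b i)"
  let ?J = "{..<n} <+> {..<n}"
  have trace: "Re (mat_trace X) = (\<Sum>i<n. d i)" if "X \<in> carrier_mat n n" "unitary_diag X W d" for X W d
    using mat_trace_congr_diag_unitary[OF unitary_diagD(1,2)[OF that], of d]
    by (simp flip: unitary_diagD(3)[OF that])
  have "(\<Sum>j\<in>?J. y j powr p) \<le> (\<Sum>j\<in>?J. x j powr p)"
  proof (rule sum_powr_le[OF _ p])
    show "0 \<le> x j" if "j \<in> ?J" for j using that \<mu>0 \<nu>0 by (auto simp: x_def)
    show "0 \<le> y j" if "j \<in> ?J" for j using that a0 b0 ba by (auto simp: y_def)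
    have "A + B + (A - B) = A + A" using A B by (intro eq_matI) auto
    then have "mat_trace (A + B) + mat_trace (A - B) = mat_trace A + mat_trace A"
      using mat_trace_add[OF P D] mat_trace_add[OF A A] by simp
    then have "(\<Sum>i<n. \<mu> i) + (\<Sum>i<n. \<nu> i) = (\<Sum>i<n. a i) + (\<Sum>i<n. a i)"
      unfolding trace[OF P W1, symmetric] trace[OF D W2, symmetric] trace[OF A U(1), symmetric]
      by (metis plus_complex.sel(1))
    then show "(\<Sum>j\<in>?J. x j) = (\<Sum>j\<in>?J. y j)"
      by (simp add: sum.Plus x_def y_def sum.distrib sum_subtractf)
    fix s :: real assume s: "0 < s"
    have "(\<Prod>i<n. (s + \<mu> i) * (s + \<nu> i)) \<le> (\<Prod>i<n. (s + a i)\<^sup>2 - (b i)\<^sup>2)"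
      by (rule det_sum_diff_le[OF A B hB psdB psdD U V W1 W2 s])
    also have "\<dots> = (\<Prod>i<n. (s + (a i + b i)) * (s + (a i - b i)))"
      by (intro prod.cong) (simp_all add: power2_eq_square algebra_simps)
    finally show "(\<Prod>j\<in>?J. s + x j) \<le> (\<Prod>j\<in>?J. s + y j)"
      by (simp add: prod.Plus x_def y_def prod.distrib)
  qed simp
  then have "(\<Sum>i<n. (a i + b i) powr p) + (\<Sum>i<n. (a i - b i) powr p) \<le>
      (\<Sum>i<n. \<mu> i powr p) + (\<Sum>i<n. \<nu> i powr p)"
    by (simp add: sum.Plus x_def y_def)
  then show ?thesis
    unfolding Splus Sminus
    using a0 b0 ba p0 trace_norm_powr[OF P W1 \<mu>0 p0] trace_norm_powr[OF D W2 \<nu>0 p0]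
    by (simp add: trace_norm_powr_mat_diag del: of_real_add of_real_diff)
qed

end
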